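(* Let $1<p<+\infty$ and $\omega\in\mathbb R$. Let $\mathcal R$ be the set of rearrangements of some function in $\mathring L^p(\mathbb S^2)$. Let $\mathcal E:\mathring L^p(\mathbb S^2)\to\mathbb R$ be a functional satisfying: (i) $\mathcal E$ is locally uniformly continuous, i.e., for any $r>0$ and any $\varepsilon>0$ there exists $\delta>0$ such that for any $f_1,f_2\in\mathring L^p(\mathbb S^2)$ with $\|f_1\|_{L^p(\mathbb S^2)}\le r$ and $\|f_2\|_{L^p(\mathbb S^2)}\le r$, $\|f_1-f_2\|_{L^p(\mathbb S^2)}<\delta$ implies $|\mathcal E(f_1)-\mathcal E(f_2)|<\varepsilon$; (ii) $\mathcal E$ is a flow invariant of $(V_\omega)$, i.e., for any smooth solution $\zeta$ of the vorticity equation $(V_\omega)$, $\mathcal E(\zeta_t)=\mathcal E(\zeta_0)$ for all $t>0$. Let $\mathcal M$ be a nonempty subset of $\mathcal R$ satisfying: (a) there exists $M\in\mathbb R$ such that $\mathcal M=\{f\in\mathcal R\mid\mathcal E(f)=M\}$; (b) for any sequence $\{f_n\}\subset\mathcal R$ with $\lim_{n\to+\infty}\mathcal E(f_n)=M$, there are a subsequence $\{f_{n_j}\}$ and some $\tilde f\in\mathcal M$ such that $\lim_{j\to+\infty}\|f_{n_j}-\tilde f\|_{L^p(\mathbb S^2)}=0$. Let $\mathcal N\subset\mathcal M$ be nonempty. If $\mathcal N$ is isolated in $\mathcal M$, then $\mathcal N$ is stable in $L^p$ norm of the absolute vorticity, i.e., for any $\varepsilon>0$ there exists $\delta>0$ such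 that for any smooth solution $\zeta$ of $(V_\omega)$, $$\min_{f\in\mathcal N}\|f-\zeta_0\|_{L^p(\mathbb S^2)}<\delta\quad\Longrightarrow\quad \min_{f\in\mathcal N}\|f-\zeta_t\|_{L^p(\mathbb S^2)}<\varepsilon\quad\forall\,t>0.$$
   Context: $\mathbb S^2$ is the unit sphere in $\mathbb R^3$ with the standard metric and area measure $\sigma$, with spherical coordinates $(\varphi,\theta)\mapsto(\cos\theta\cos\varphi,\cos\theta\sin\varphi,\sin\theta)$; thus $\sin\theta=x_3$. All functions are real-valued. $\mathring L^p(\mathbb S^2)$ is the space of $L^p$ functions with zero mean. For $1<r<\infty$ and $f\in\mathring L^r(\mathbb S^2)$, $\mathcal Gf$ is the unique zero-mean function in $W^{2,r}(\mathbb S^2)$ with $-\Delta(\mathcal Gf)=f$ ($\Delta$ the Laplace-Beltrami operator). $J$ is the anticlockwise rotation by $\pi/2$ in the tangent planes, i.e. $J\mathbf v=\mathbf x\times\mathbf v$ at $\mathbf x\in\mathbb S^2$; in coordinates $J\nabla f=-\partial_\theta f\,\mathbf e_\varphi+\frac1{\cos\theta}\partial_\varphi f\,\mathbf e_\theta$. For a fixed rotation speed $\omega\in\mathbb R$, the vorticity equation $(V_\omega)$ for the absolute vorticity $\zeta$ is $$\partial_t\zeta+J\nabla(\omega\sin\theta-\mathcal G\zeta)\cdot\nabla\zeta=0\quad\text{on }\mathbb S^2,\ t>0.$$ A smooth solution is a smooth function $\zeta$ on $\mathbb S^2\times[0,\infty)$, of zero mean on $\mathbb S^2$ at each time, satisfying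 this equation; $\zeta_t:=\zeta(\cdot,t)$. The set of rearrangements of a measurable $f:\mathbb S^2\to\mathbb R$ is the set $\mathcal R_f$ of all measurable $g:\mathbb S^2\to\mathbb R$ such that $\sigma(\{g>s\})=\sigma(\{f>s\})$ for all $s\in\mathbb R$. For $\mathcal B\subset\mathcal A\subset L^p(\mathbb S^2)$, $\mathcal B$ is isolated in $\mathcal A$ if $\inf_{f\in\mathcal B,\,g\in\mathcal A\setminus\mathcal B}\|f-g\|_{L^p(\mathbb S^2)}>0$, the infimum being $+\infty$ by convention if $\mathcal B$ or $\mathcal A\setminus\mathcal B$ is empty. *)

theory Defs
  imports "HOL-Analysis.Analysis"
begin

abbreviation S2 :: "(real^3) set" where
  "S2 \<equiv> sphere 0 1"

definition spherical_coords :: "real \<times> real \<Rightarrow> real^3" where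
  "spherical_coords = (\<lambda>(\<phi>, \<theta>). vector [cos \<theta> * cos \<phi>, cos \<theta> * sin \<phi>, sin \<theta>])"

text \<open>In these coordinates the standard metric is \<open>cos\<^sup>2 \<theta> d\<phi>\<^sup>2 + d\<theta>\<^sup>2\<close>, so the area element is
  \<open>cos \<theta> d\<phi> d\<theta>\<close>. The measure lives on the Borel sets of the sphere, so everything
  below depends on functions \<open>real^3 \<Rightarrow> real\<close> only through their values on the sphere.\<close>

definition area :: "(real^3) measure" where
  "area = distr
     (density lborel (\<lambda>(\<phi>, \<theta>). indicator ({-pi<..pi} \<times> {-(pi/2)..pi/2}) (\<phi>, \<theta>) * ennreal (cos \<theta>)))
     (restrict_space borel S2) spherical_coords"

definition Lp :: "real \<Rightarrow> (real^3 \<Rightarrow> real) set" where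
  "Lp p = {f \<in> borel_measurable area. integrable area (\<lambda>x. \<bar>f x\<bar> powr p)}"

definition Lp_norm :: "real \<Rightarrow> (real^3 \<Rightarrow> real) \<Rightarrow> real" where
  "Lp_norm p f = (\<integral>x. \<bar>f x\<bar> powr p \<partial>area) powr (1 / p)"

definition Lp0 :: "real \<Rightarrow> (real^3 \<Rightarrow> real) set" where
  "Lp0 p = {f \<in> Lp p. (\<integral>x. f x \<partial>area) = 0}"

definition rearrangements :: "(real^3 \<Rightarrow> real) \<Rightarrow> (real^3 \<Rightarrow> real) set" where
  "rearrangements f = {g \<in> borel_measurable area.
     \<forall>s. emeasure area {x \<in> space area. g x > s} = emeasure area {x \<in> space area. f x > s}}"

definition Lp_isolated :: "real \<Rightarrow> (real^3 \<Rightarrow> real) set \<Rightarrow> (real^3 \<Rightarrow> real) set \<Rightarrow> bool" where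
  "Lp_isolated p B A \<longleftrightarrow> (INF (f, g) \<in> B \<times> (A - B). ereal (Lp_norm p (\<lambda>x. f x - g x))) > 0"

primrec Ck_on :: "nat \<Rightarrow> ('a::euclidean_space \<Rightarrow> 'b::real_normed_vector) \<Rightarrow> 'a set \<Rightarrow> bool" where
  "Ck_on 0 f U \<longleftrightarrow> continuous_on U f"
| "Ck_on (Suc k) f U \<longleftrightarrow>
     f differentiable_on U \<and> (\<forall>b\<in>Basis. Ck_on k (\<lambda>x. frechet_derivative f (at x) b) U)"

text \<open>Smoothness on a set that need not be open means being the restriction of a smooth function on
  an open neighbourhood. For the sphere and for the manifold with boundary
  \<open>S2 \<times> {0..}\<close> this is the usual intrinsic notion.\<close>

definition smooth_on :: "'a::euclidean_space set \<Rightarrow> ('a \<Rightarrow> 'b::real_normed_vector) \<Rightarrow> bool" where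
  "smooth_on A f \<longleftrightarrow>
     (\<exists>U g. open U \<and> A \<subseteq> U \<and> (\<forall>k. Ck_on k g U) \<and> (\<forall>x\<in>A. g x = f x))"

text \<open>Tangential derivatives are computed through the extension \<open>y \<mapsto> f (sgn y) = f (y / \<parallel>y\<parallel>)\<close>, which is
  constant along rays: at a point of the sphere its Euclidean gradient is the (tangential) Riemannian
  gradient of \<open>f\<close>, and, for a tangent field \<open>X\<close>, its Euclidean divergence is the Riemannian divergence
  of \<open>X\<close>.\<close>

definition sph_grad :: "(real^3 \<Rightarrow> real) \<Rightarrow> real^3 \<Rightarrow> real^3" where
  "sph_grad f x = (\<chi> i. frechet_derivative (\<lambda>y. f (sgn y)) (at x) (axis i 1))"

definition sph_div :: "(real^3 \<Rightarrow> real^3) \<Rightarrow> real^3 \<Rightarrow> real" where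
  "sph_div X x = (\<Sum>i\<in>UNIV. frechet_derivative (\<lambda>y. X (sgn y)) (at x) (axis i 1) $ i)"

definition smooth_tangent_field :: "(real^3 \<Rightarrow> real^3) \<Rightarrow> bool" where
  "smooth_tangent_field X \<longleftrightarrow> smooth_on S2 X \<and> (\<forall>x\<in>S2. x \<bullet> X x = 0)"

definition weak_grad :: "(real^3 \<Rightarrow> real) \<Rightarrow> (real^3 \<Rightarrow> real^3) \<Rightarrow> bool" where
  "weak_grad u V \<longleftrightarrow> integrable area u \<and> integrable area V \<and> (AE x in area. x \<bullet> V x = 0) \<and>
     (\<forall>X. smooth_tangent_field X \<longrightarrow>
        (\<integral>x. u x * sph_div X x \<partial>area) = - (\<integral>x. V x \<bullet> X x \<partial>area))"

text \<open>\<open>sobolev k r\<close> is \<open>W\<^sup>k\<^sup>,\<^sup>r\<close> of the sphere: the components in \<open>\<real>\<^sup>3\<close> of the weak gradient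
  are the tangential derivatives \<open>D\<^sub>1 u, D\<^sub>2 u, D\<^sub>3 u\<close>, and all iterated tangential derivatives up to
  order \<open>k\<close> are required to lie in \<open>L\<^sup>r\<close>.\<close>

primrec sobolev :: "nat \<Rightarrow> real \<Rightarrow> (real^3 \<Rightarrow> real) set" where
  "sobolev 0 r = Lp r"
| "sobolev (Suc k) r =
     {u \<in> Lp r. \<exists>V. weak_grad u V \<and> (\<forall>i. (\<lambda>x. V x $ i) \<in> sobolev k r)}"

text \<open>The Laplace-Beltrami operator as \<open>D\<^sub>1 D\<^sub>1 + D\<^sub>2 D\<^sub>2 + D\<^sub>3 D\<^sub>3\<close>, i.e. the divergence of the gradient.\<close>

definition has_laplacian :: "(real^3 \<Rightarrow> real) \<Rightarrow> (real^3 \<Rightarrow> real) \<Rightarrow> bool" where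
  "has_laplacian u g \<longleftrightarrow> (\<exists>V H. weak_grad u V \<and> (\<forall>i. weak_grad (\<lambda>x. V x $ i) (H i)) \<and>
     (AE x in area. (\<Sum>i\<in>UNIV. H i x $ i) = g x))"

text \<open>\<open>inv_laplacian f\<close> is a representative of the almost-everywhere class \<open>\<G> f\<close>; the class does not
  depend on the exponent \<open>r\<close>, since the spaces \<open>W\<^sup>2\<^sup>,\<^sup>r\<close> decrease with \<open>r\<close>.\<close>

definition inv_laplacian :: "(real^3 \<Rightarrow> real) \<Rightarrow> real^3 \<Rightarrow> real" where
  "inv_laplacian f = (SOME u. \<exists>r>1. f \<in> Lp0 r \<and> u \<in> sobolev 2 r \<and>
     (\<integral>x. u x \<partial>area) = 0 \<and> has_laplacian u (\<lambda>x. - f x))"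

definition rot90 :: "real^3 \<Rightarrow> real^3 \<Rightarrow> real^3" where
  "rot90 x v = cross3 x v"

text \<open>Since \<open>\<G> \<zeta>\<close> is an almost-everywhere class, its gradient is the weak one. For smooth \<open>\<zeta>\<close> it has a
  continuous (even smooth) representative by elliptic regularity, which is unique; \<open>W\<close> is that
  representative of the gradient of \<open>\<omega> sin \<theta> - \<G> \<zeta>\<close> and the equation holds at every point.\<close>

definition smooth_solution :: "real \<Rightarrow> (real \<Rightarrow> real^3 \<Rightarrow> real) \<Rightarrow> bool" where
  "smooth_solution \<omega> \<zeta> \<longleftrightarrow>
     smooth_on (S2 \<times> {0..}) (\<lambda>(x, t). \<zeta> t x) \<and>
     (\<forall>t\<ge>0. (\<integral>x. \<zeta> t x \<partial>area) = 0) \<and>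
     (\<forall>t>0. \<exists>W. continuous_on S2 W \<and> weak_grad (\<lambda>x. \<omega> * x $ 3 - inv_laplacian (\<zeta> t) x) W \<and>
        (\<forall>x\<in>S2. deriv (\<lambda>s. \<zeta> s x) t + rot90 x (W x) \<bullet> sph_grad (\<zeta> t) x = 0))"

text \<open>The minimum of the distances from \<open>g\<close> to the elements of \<open>N\<close>, as the least element of a set of
  reals; it is only meaningful if the minimum is attained.\<close>

definition min_dist :: "real \<Rightarrow> (real^3 \<Rightarrow> real) set \<Rightarrow> (real^3 \<Rightarrow> real) \<Rightarrow> real" where
  "min_dist p N g = (LEAST d. d \<in> (\<lambda>f. Lp_norm p (\<lambda>x. f x - g x)) ` N)"

end

theory Submission
  imports Defs "HOL-Probability.Weak_Convergence"
begin

text \<open>If stability failed, there would be solutions starting ever closer to \<open>\<N>\<close> which, by continuity in time, reach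
  a fixed small distance \<open>\<epsilon>'\<close> from \<open>\<N>\<close>. Every \<open>\<zeta>\<^sub>t\<close> is a rearrangement of \<open>\<zeta>\<^sub>0\<close>, so an element of \<open>\<N>\<close> near
  \<open>\<zeta>\<^sub>0\<close> has a rearrangement, a follower, which is equally near to \<open>\<zeta>\<^sub>t\<close>. The followers lie in \<open>\<R>\<close> and, \<open>\<E>\<close> being
  conserved and uniformly continuous, have energies tending to \<open>M\<close>; by compactness they accumulate at a point of
  \<open>\<M>\<close> at distance \<open>\<epsilon>'\<close> from \<open>\<N>\<close>, which is impossible if \<open>\<epsilon>'\<close> is smaller than the isolation distance.

  That \<open>\<zeta>\<^sub>t\<close> is a rearrangement of \<open>\<zeta>\<^sub>0\<close> is shown through the conservation of the moments \<open>\<integral>\<zeta>\<^sup>n\<close>. The follower is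
  built without a flow map: the vorticity is discretised, and on each level set the quantile function of the
  prescribed conditional law is composed with a uniformly distributed function of the latitude.\<close>

section \<open>Functions with a prescribed joint law\<close>

text \<open>Hypothesis (b) speaks of sequences in \<open>\<R>\<close> only, and
  \<open>\<zeta> t\<close> need not lie in \<open>\<R>\<close>; this is what the followers are for.
  The natural follower, an element of \<open>\<N>\<close> carried along by the flow, is not at hand,
  because the velocity is given at each time separately. What matters about it is only that the pair
  (\<open>\<zeta> t\<close>, follower) has the joint law of the pair (\<open>\<zeta> 0\<close>,
  element of \<open>\<N>\<close>), and such a function can be built by measure theory alone: all it
  takes is a variable without atoms on each level set, and the latitude provides one. Matching the
  joint law for \<open>\<zeta> t\<close> itself would call for conditional laws on uncountably many,
  possibly null, level sets; rounding the vorticity to a grid leaves countably many cells at the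
  price of an arbitrarily small error. Moments suffice to recover the law because a smooth vorticity
  is bounded on the sphere.\<close>

text \<open>Probability integral transform for a measure of arbitrary finite mass. Without atoms the
  cdf is continuous, so the sublevel set, if nonempty and proper, is a closed half-line
  \<open>{..m}\<close>, and right continuity at \<open>m\<close> gives
  \<open>cdf M m = u\<close>.\<close>

lemma (in finite_borel_measure) measure_cdf_le:
  assumes atomless: "\<And>c. measure M {c} = 0" and u: "0 \<le> u" "u \<le> measure M (space M)"
  shows "measure M {v. cdf M v \<le> u} = u"
\<comment> \<open>The top value is set apart because the sublevel set is then the whole line and has
  no supremum.\<close>
proof (cases "u = measure M (space M)")
  case True
  have "{v. cdf M v \<le> u} = space M"
    using cdf_bounded True borel_UNIV by auto
  then show ?thesis using True by simp
next
  case False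
  let ?S = "{v. cdf M v \<le> u}"
  have cont: "continuous_on UNIV (cdf M)"
    using isCont_cdf atomless by (simp add: continuous_at_imp_continuous_on)
  show ?thesis
  proof (cases "?S = {}")
    case True
    have "u \<le> 0"
      by (rule tendsto_lowerbound[OF cdf_lim_at_bot])
        (use True in \<open>auto intro!: always_eventually simp: not_le less_imp_le\<close>)
    with True u show ?thesis by simp
  next
    case ne: False
    have "\<forall>\<^sub>F v in at_top. u < cdf M v"
      by (rule order_tendstoD(1)[OF cdf_lim_at_top]) (use False u in auto)
    then obtain b where b: "\<And>v. b \<le> v \<Longrightarrow> u < cdf M v"
      by (auto simp: eventually_at_top_linorder)
    have bdd: "bdd_above ?S"
    proof (rule bdd_aboveI[of _ b])
      show "v \<le> b" if "v \<in> ?S" for v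
        using b[of v] that by (cases "b \<le> v") auto
    qed
    define m where "m = Sup ?S"
    have "closed ?S"
      by (intro closed_Collect_le cont) auto
    then have m: "m \<in> ?S"
      unfolding m_def by (intro closed_contains_Sup ne bdd)
    have S: "?S = {..m}"
    proof (intro set_eqI iffI)
      show "v \<in> {..m}" if "v \<in> ?S" for v
        using cSup_upper[OF that bdd] by (simp add: m_def)
      show "v \<in> ?S" if "v \<in> {..m}" for v
        using cdf_nondecreasing[of v m] m that by auto
    qed
    have "u \<le> cdf M m"
    proof (rule tendsto_lowerbound)
      show "(cdf M \<longlongrightarrow> cdf M m) (at_right m)"
        using cdf_is_right_cont by (simp add: continuous_within)
      have ge: "u \<le> cdf M v" if "m < v" for v
      proof -
        have "v \<notin> ?S" unfolding S using that by simp
        then show ?thesis by simp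
      qed
      show "\<forall>\<^sub>F v in at_right m. u \<le> cdf M v"
        by (rule eventually_mono[OF eventually_at_right_less ge])
    qed simp
    then show ?thesis
      unfolding S using m by (simp add: cdf_def)
  qed
qed

text \<open>Over the set \<open>B j\<close> where \<open>l = j\<close>, the cdf of
  \<open>Q j\<close> composed with \<open>V\<close> is uniform on the interval from 0 to
  \<open>measure M (B j)\<close>. The quantile function of the law of \<open>f\<close> over
  \<open>A j\<close>, the set where \<open>k = j\<close>, turns it into that law;
  \<open>same\<close> makes the two total masses agree. Gluing over the countably many
  \<open>j\<close> gives \<open>f'\<close>.\<close>

lemma (in finite_measure) exists_equal_joint_law:
  fixes f V :: "'a \<Rightarrow> real" and k l :: "'a \<Rightarrow> 'i::countable"
  assumes f[measurable]: "f \<in> borel_measurable M" and V[measurable]: "V \<in> borel_measurable M"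
    and k[measurable]: "k \<in> measurable M (count_space UNIV)"
    and l[measurable]: "l \<in> measurable M (count_space UNIV)"
    and same: "\<And>j. measure M {x \<in> space M. k x = j} = measure M {x \<in> space M. l x = j}"
    and atomless: "\<And>c. measure M {x \<in> space M. V x = c} = 0"
  obtains f' where "f' \<in> borel_measurable M"
    and "distr M (count_space UNIV \<Otimes>\<^sub>M borel) (\<lambda>x. (l x, f' x))
       = distr M (count_space UNIV \<Otimes>\<^sub>M borel) (\<lambda>x. (k x, f x))"
proof -
  define A where "A j = {x \<in> space M. k x = j}" for j
  define B where "B j = {x \<in> space M. l x = j}" for j
  have A[measurable]: "A j \<in> sets M" and B[measurable]: "B j \<in> sets M" for j
    by (auto simp: A_def B_def)
  have AB: "measure M (A j) = measure M (B j)" for j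
    using same by (simp add: A_def B_def)
  define P where "P j = distr (restrict_space M (A j)) borel f" for j
  define Q where "Q j = distr (restrict_space M (B j)) borel V" for j
  interpret P: finite_borel_measure "P j" for j
    unfolding P_def finite_borel_measure_def finite_borel_measure_axioms_def
    by (auto intro!: finite_measure.finite_measure_distr finite_measure_restrict_space
        measurable_restrict_space1 finite_measure_axioms)
  interpret Q: finite_borel_measure "Q j" for j
    unfolding Q_def finite_borel_measure_def finite_borel_measure_axioms_def
    by (auto intro!: finite_measure.finite_measure_distr finite_measure_restrict_space
        measurable_restrict_space1 finite_measure_axioms)
  have measure_P: "measure (P j) S = measure M (A j \<inter> {x. f x \<in> S})"
    if [measurable]: "S \<in> sets borel" for j S
    unfolding P_def
    by (subst measure_distr)
      (auto intro!: measurable_restrict_space1 arg_cong[where f="measure M"]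
        simp: measure_restrict_space space_restrict_space A_def)
  have measure_Q: "measure (Q j) S = measure M (B j \<inter> {x. V x \<in> S})"
    if [measurable]: "S \<in> sets borel" for j S
    unfolding Q_def
    by (subst measure_distr)
      (auto intro!: measurable_restrict_space1 arg_cong[where f="measure M"]
        simp: measure_restrict_space space_restrict_space B_def)
  have space_P: "measure (P j) (space (P j)) = measure M (A j)" for j
    using measure_P[of UNIV j] P.borel_UNIV by simp
  have space_Q: "measure (Q j) (space (Q j)) = measure M (B j)" for j
    using measure_Q[of UNIV j] Q.borel_UNIV by simp
  have "measure (Q j) {c} \<le> 0" for j c
    using finite_measure_mono[of "B j \<inter> {x. V x \<in> {c}}" "{x \<in> space M. V x = c}"] atomless
    by (auto simp: measure_Q B_def)
  then have Q_atomless: "measure (Q j) {c} = 0" for j c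
    by (meson antisym measure_nonneg)
  let ?G = "\<lambda>j. cdf (Q j)" and ?b = "\<lambda>j. measure M (B j)"
  have G[measurable]: "?G j \<in> borel_measurable borel" for j
    by (intro borel_measurable_mono monoI Q.cdf_nondecreasing)
  have unif: "measure M (B j \<inter> {x. ?G j (V x) \<le> u}) = u" if "0 \<le> u" "u \<le> ?b j" for j u
    using Q.measure_cdf_le[OF Q_atomless, of u j] that by (simp add: space_Q measure_Q)
  have null0: "measure M (B j \<inter> {x. ?G j (V x) \<le> 0}) = 0" for j
    by (rule unif) auto
  \<comment> \<open>The comparison level \<open>max 0 (?b j - e)\<close> leaves at most mass
    \<open>e\<close> above it, by \<open>unif\<close>.\<close>
  have nullb: "measure M (B j \<inter> {x. ?b j \<le> ?G j (V x)}) = 0" for j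
  proof -
    have "measure M (B j \<inter> {x. ?b j \<le> ?G j (V x)}) \<le> 0"
    proof (rule field_le_epsilon)
      fix e :: real assume e: "0 < e"
      define u where "u = max 0 (?b j - e)"
      show "measure M (B j \<inter> {x. ?b j \<le> ?G j (V x)}) \<le> 0 + e"
      proof (cases "?b j = 0")
        case True
        then show ?thesis
          using finite_measure_mono[of "B j \<inter> {x. ?b j \<le> ?G j (V x)}" "B j"] e by auto
      next
        case False
        then have u: "0 \<le> u" "u \<le> ?b j" "u < ?b j" "?b j - u \<le> e"
          using e by (auto simp: u_def zero_less_measure_iff)
        have [measurable]: "B j \<inter> {x. ?G j (V x) \<le> u} \<in> sets M"
          unfolding B_def by (simp add: Int_def)
        have "measure M (B j \<inter> {x. ?b j \<le> ?G j (V x)}) \<le> measure M (B j - (B j \<inter> {x. ?G j (V x) \<le> u}))"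
          by (rule finite_measure_mono) (use u in auto)
        also have "\<dots> = ?b j - u"
          by (subst finite_measure_Diff) (auto simp: unif u)
        finally show ?thesis using u by simp
      qed
    qed
    then show ?thesis by (meson antisym measure_nonneg)
  qed
  \<comment> \<open>\<open>R.I j\<close> is the quantile function of \<open>P j\<close>:
    \<open>u \<le> cdf (P j) x\<close> iff \<open>R.I j u \<le> x\<close>, for \<open>u\<close>
    strictly between the limits 0 and \<open>?b j\<close> of the cdf.\<close>
  interpret R: right_continuous_mono "cdf (P j)" 0 "?b j" for j
    using P.cdf_lim_at_top[of j] P.cdf_lim_at_bot[of j]
    by unfold_locales (auto simp: P.cdf_is_right_cont P.cdf_nondecreasing monoI space_P AB)
  \<comment> \<open>The default 0 is used only outside the open interval, which the uniform variable
    leaves only on a null set by \<open>null0\<close> and \<open>nullb\<close>.\<close>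
  define q where "q j u = (if u \<in> {0<..<?b j} then R.I j u else 0)" for j u
  have [measurable]: "q j \<in> borel_measurable borel" for j
    unfolding q_def
    by (subst measurable_restrict_space_iff[symmetric])
      (auto intro!: borel_measurable_mono_on_fnc R.mono_I)
  define f' where "f' x = q (l x) (?G (l x) (V x))" for x
  have f'[measurable]: "f' \<in> borel_measurable M"
    unfolding f'_def by (rule measurable_compose_countable[OF _ l]) measurable
  have law: "measure M (B j \<inter> {x. f' x \<le> s}) = measure M (A j \<inter> {x. f x \<le> s})" for j s
  proof -
    have [measurable]: "B j \<inter> {x. f' x \<le> s} \<in> sets M" "B j \<inter> {x. ?G j (V x) \<le> cdf (P j) s} \<in> sets M"
      "B j \<inter> {x. ?G j (V x) \<le> 0} \<in> sets M" "B j \<inter> {x. ?b j \<le> ?G j (V x)} \<in> sets M"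
      unfolding B_def by (simp_all add: Int_def)
    have "AE x in M. x \<notin> B j \<inter> {x. ?G j (V x) \<le> 0}" "AE x in M. x \<notin> B j \<inter> {x. ?b j \<le> ?G j (V x)}"
      by (intro AE_not_in null_setsI; simp add: emeasure_eq_measure null0 nullb)+
    then have "AE x in M. x \<in> B j \<inter> {x. f' x \<le> s} \<longleftrightarrow> x \<in> B j \<inter> {x. ?G j (V x) \<le> cdf (P j) s}"
    proof eventually_elim
      case (elim x)
      show ?case
      proof (cases "x \<in> B j")
        case True
        then have G: "0 < ?G j (V x)" "?G j (V x) < ?b j" and l: "l x = j"
          using elim by (auto simp: B_def)
        have "f' x = R.I j (?G j (V x))"
          using G l by (simp add: f'_def q_def)
        moreover have "?G j (V x) \<le> cdf (P j) s \<longleftrightarrow> R.I j (?G j (V x)) \<le> s"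
          by (rule R.pseudoinverse[OF G])
        ultimately show ?thesis
          using True by (simp only: Int_iff mem_Collect_eq)
      qed simp
    qed
    then have "measure M (B j \<inter> {x. f' x \<le> s}) = measure M (B j \<inter> {x. ?G j (V x) \<le> cdf (P j) s})"
      by (intro measure_eq_AE) auto
    also have "\<dots> = cdf (P j) s"
      using P.cdf_bounded[of j s] by (intro unif P.cdf_nonneg) (simp add: space_P AB)
    also have "\<dots> = measure M (A j \<inter> {x. f x \<le> s})"
      by (simp add: cdf_def measure_P)
    finally show ?thesis .
  qed
  let ?N = "count_space (UNIV :: 'i set) \<Otimes>\<^sub>M (borel :: real measure)"
  \<comment> \<open>The empty set makes the generator stable under intersection, since distinct
    singletons are disjoint.\<close>
  let ?Ea = "insert {} (range (\<lambda>j::'i. {j}))" and ?Eb = "range (atMost :: real \<Rightarrow> real set)"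
  let ?E = "{a \<times> b | a b. a \<in> ?Ea \<and> b \<in> ?Eb}"
  have UN_atMost: "(\<Union>n. {..real n}) = UNIV"
    by (auto intro: real_arch_simple)
  have sets_N: "sets ?N = sets (sigma UNIV ?E)"
  proof -
    have "sets ?N = sets (sigma (space (count_space UNIV) \<times> space borel) ?E)"
    proof (rule sets_pair_eq)
      show "sets (count_space UNIV) = sigma_sets (space (count_space UNIV)) ?Ea"
      proof -
        have "X \<in> sigma_sets UNIV ?Ea" for X :: "'i set"
        proof -
          have "(\<Union>j\<in>X. {j}) \<in> sigma_sets UNIV ?Ea"
            by (rule sigma_sets_UNION) (auto intro: sigma_sets.Basic)
          then show ?thesis by simp
        qed
        then show ?thesis by auto
      qed
      show "sets (borel :: real measure) = sigma_sets (space borel) ?Eb"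
        unfolding borel_eq_atMost by simp
      show "countable ?Ea" by simp
      show "countable (range (\<lambda>n. {..real n}))" by simp
      show "\<Union> (range (\<lambda>n. {..real n})) = space borel"
        using UN_atMost by simp
    qed auto
    then show ?thesis by simp
  qed
  have "distr M ?N (\<lambda>x. (l x, f' x)) = distr M ?N (\<lambda>x. (k x, f x))"
  proof (rule measure_eqI_generator_eq_countable[where E="?E" and \<Omega>=UNIV])
    show "Int_stable ?E"
    proof (rule Int_stableI)
      fix X Y assume "X \<in> ?E" "Y \<in> ?E"
      then obtain a b a' b' where XY: "X = a \<times> {..b}" "Y = a' \<times> {..b'}" and a: "a \<in> ?Ea" "a' \<in> ?Ea"
        by blast
      have "a \<inter> a' \<in> ?Ea" using a by auto
      moreover have "X \<inter> Y = (a \<inter> a') \<times> {..min b b'}"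
        by (simp add: XY Times_Int_Times Int_atMost)
      ultimately show "X \<inter> Y \<in> ?E" by blast
    qed
    let ?C = "{{j::'i} \<times> {..real n} | j n. True}"
    show "?C \<subseteq> ?E" by blast
    have "?C = (\<lambda>(j, n). {j} \<times> {..real n}) ` UNIV" by auto
    then show "countable ?C" by (simp only: countable_image countableI_type)
    show "\<Union> ?C = UNIV"
    proof (intro equalityI subsetI)
      fix z :: "'i \<times> real" assume "z \<in> UNIV"
      obtain n where "snd z \<le> real n" using real_arch_simple by blast
      then have "z \<in> {fst z} \<times> {..real n}" by (cases z) auto
      moreover have "{fst z} \<times> {..real n} \<in> ?C" by blast
      ultimately show "z \<in> \<Union> ?C" by (rule UnionI[rotated])
    qed (rule UNIV_I)
    show "sets (distr M ?N (\<lambda>x. (l x, f' x))) = sigma_sets UNIV ?E"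
      "sets (distr M ?N (\<lambda>x. (k x, f x))) = sigma_sets UNIV ?E"
      by (simp_all add: sets_N)
    show "emeasure (distr M ?N (\<lambda>x. (l x, f' x))) X \<noteq> \<infinity>" for X
      by (subst infinity_ennreal_def, rule finite_measure.emeasure_finite, rule finite_measure_distr) measurable
  next
    fix X assume "X \<in> ?E"
    then consider s where "X = {}" | j s where "X = {j} \<times> {..s}" by auto
    then show "emeasure (distr M ?N (\<lambda>x. (l x, f' x))) X = emeasure (distr M ?N (\<lambda>x. (k x, f x))) X"
    proof cases
      case (2 j s)
      have 1: "(\<lambda>x. (l x, f' x)) -` X \<inter> space M = B j \<inter> {x. f' x \<le> s}"
        and 2: "(\<lambda>x. (k x, f x)) -` X \<inter> space M = A j \<inter> {x. f x \<le> s}"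
        using 2 by (auto simp: A_def B_def)
      have "X \<in> sets ?N" unfolding \<open>X = {j} \<times> {..s}\<close> by (intro pair_measureI) auto
      then show ?thesis
        by (simp add: emeasure_distr 1 2 emeasure_eq_measure law)
    qed simp
  qed auto
  with f' show thesis by (rule that)
qed

section \<open>Minkowski's inequality\<close>

text \<open>Away from the end point 0 this is \<open>powr_convex\<close>. If \<open>x\<close> or
  \<open>y\<close> is 0, convexity reduces to \<open>(c * z) powr p \<le> c * z powr p\<close> for
  \<open>c\<close> between 0 and 1, which holds because \<open>c powr p \<le> c\<close>.\<close>

lemma convex_on_powr_nonneg:
  assumes "p \<ge> 1"
  shows "convex_on {0..} (\<lambda>x::real. x powr p)"
proof (rule convex_onI)
  fix t x y :: real assume t: "0 < t" "t < 1" and xy: "x \<in> {0..}" "y \<in> {0..}"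
  have small: "(c * z) powr p \<le> c * z powr p" if "0 < c" "c < 1" "0 \<le> z" for c z
    using powr_mono'[of 1 p c] assms that by (simp add: powr_mult mult_right_mono)
  show "((1 - t) *\<^sub>R x + t *\<^sub>R y) powr p \<le> (1 - t) * x powr p + t * y powr p"
  proof (cases "x = 0 \<or> y = 0")
    case True
    then show ?thesis
      using small[of t y] small[of "1 - t" x] t xy by auto
  next
    case False
    then show ?thesis
      using convex_onD[OF powr_convex[OF assms], of t x y] t xy by auto
  qed
qed simp

text \<open>Convexity of the power with weights \<open>a / (a + b)\<close> and
  \<open>b / (a + b)\<close>, applied to \<open>\<bar>f x\<bar> / a\<close> and
  \<open>\<bar>g x\<bar> / b\<close>, gives \<open>bound\<close>. If \<open>a\<close> and
  \<open>b\<close> are the two norms, the right-hand side integrates to exactly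
  \<open>(a + b) powr p\<close>; the choice \<open>a = b = 1\<close> yields integrability. A
  vanishing norm means that the function is zero almost everywhere.\<close>

lemma Minkowski_inequality:
  fixes f g :: "'a \<Rightarrow> real"
  assumes p: "1 \<le> p"
    and f[measurable]: "f \<in> borel_measurable M" and fi: "integrable M (\<lambda>x. \<bar>f x\<bar> powr p)"
    and g[measurable]: "g \<in> borel_measurable M" and gi: "integrable M (\<lambda>x. \<bar>g x\<bar> powr p)"
  shows "integrable M (\<lambda>x. \<bar>f x + g x\<bar> powr p)" (is ?I)
    and "(\<integral>x. \<bar>f x + g x\<bar> powr p \<partial>M) powr (1 / p)
      \<le> (\<integral>x. \<bar>f x\<bar> powr p \<partial>M) powr (1 / p) + (\<integral>x. \<bar>g x\<bar> powr p \<partial>M) powr (1 / p)" (is ?L)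
proof -
  note conv = convex_on_powr_nonneg[OF p]
  have bound: "\<bar>f x + g x\<bar> powr p \<le> (a + b) powr p * (a / (a + b) * (\<bar>f x\<bar> powr p / a powr p)
      + b / (a + b) * (\<bar>g x\<bar> powr p / b powr p))" if ab: "0 < a" "0 < b" for a b :: real and x
  proof -
    have e: "a + b \<noteq> 0" "1 - b / (a + b) = a / (a + b)"
      using ab by (simp_all add: field_simps)
    have "\<bar>f x + g x\<bar> powr p \<le> (\<bar>f x\<bar> + \<bar>g x\<bar>) powr p"
      using p by (intro powr_mono2) auto
    also have "\<bar>f x\<bar> + \<bar>g x\<bar> = (a + b) * ((1 - b / (a + b)) *\<^sub>R (\<bar>f x\<bar> / a) + (b / (a + b)) *\<^sub>R (\<bar>g x\<bar> / b))"
      using ab by (simp add: e distrib_left)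
    also have "\<dots> powr p = (a + b) powr p * ((1 - b / (a + b)) *\<^sub>R (\<bar>f x\<bar> / a) + (b / (a + b)) *\<^sub>R (\<bar>g x\<bar> / b)) powr p"
      by (rule powr_mult)
    also have "\<dots> \<le> (a + b) powr p * ((1 - b / (a + b)) * (\<bar>f x\<bar> / a) powr p + (b / (a + b)) * (\<bar>g x\<bar> / b) powr p)"
      by (rule mult_left_mono[OF convex_onD[OF conv]]) (use ab in auto)
    also have "1 - b / (a + b) = a / (a + b)"
      by (rule e)
    finally show ?thesis using ab by (simp add: powr_divide)
  qed
  show ?I
  proof (rule Bochner_Integration.integrable_bound)
    show "integrable M (\<lambda>x. 2 powr p * (1 / 2 * \<bar>f x\<bar> powr p + 1 / 2 * \<bar>g x\<bar> powr p))"
      using fi gi by auto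
    show "AE x in M. norm (\<bar>f x + g x\<bar> powr p) \<le> norm (2 powr p * (1 / 2 * \<bar>f x\<bar> powr p + 1 / 2 * \<bar>g x\<bar> powr p))"
      using bound[of 1 1] by (intro AE_I2) auto
  qed measurable
  define a where "a = (\<integral>x. \<bar>f x\<bar> powr p \<partial>M) powr (1 / p)"
  define b where "b = (\<integral>x. \<bar>g x\<bar> powr p \<partial>M) powr (1 / p)"
  have ap: "a powr p = (\<integral>x. \<bar>f x\<bar> powr p \<partial>M)" and bp: "b powr p = (\<integral>x. \<bar>g x\<bar> powr p \<partial>M)"
    using p by (simp_all add: a_def b_def powr_powr)
  have zero: "AE x in M. h x = 0" if "integrable M (\<lambda>x. \<bar>h x\<bar> powr p)"
    "(\<integral>x. \<bar>h x\<bar> powr p \<partial>M) powr (1 / p) = 0" for h :: "'a \<Rightarrow> real"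
    using integral_nonneg_eq_0_iff_AE[OF that(1)] that(2) by auto
  consider "a = 0" | "b = 0" | "a > 0" "b > 0"
    using powr_ge_zero unfolding a_def b_def by (metis less_eq_real_def)
  then have "(\<integral>x. \<bar>f x + g x\<bar> powr p \<partial>M) powr (1 / p) \<le> a + b"
  proof cases
    case 1
    then have "AE x in M. f x = 0" using zero[OF fi] by (simp add: a_def)
    then have "(\<integral>x. \<bar>f x + g x\<bar> powr p \<partial>M) = (\<integral>x. \<bar>g x\<bar> powr p \<partial>M)"
      by (intro integral_cong_AE) auto
    then show ?thesis by (simp add: a_def b_def)
  next
    case 2
    then have "AE x in M. g x = 0" using zero[OF gi] by (simp add: b_def)
    then have "(\<integral>x. \<bar>f x + g x\<bar> powr p \<partial>M) = (\<integral>x. \<bar>f x\<bar> powr p \<partial>M)"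
      by (intro integral_cong_AE) auto
    then show ?thesis by (simp add: a_def b_def)
  next
    case 3
    have "(\<integral>x. \<bar>f x + g x\<bar> powr p \<partial>M) \<le> (\<integral>x. (a + b) powr p * (a / (a + b) * (\<bar>f x\<bar> powr p / a powr p)
      + b / (a + b) * (\<bar>g x\<bar> powr p / b powr p)) \<partial>M)"
      using fi gi \<open>?I\<close> by (intro integral_mono bound 3) auto
    also have "\<dots> = (a + b) powr p * (a / (a + b) * (a powr p / a powr p) + b / (a + b) * (b powr p / b powr p))"
      using fi gi by (simp add: ap bp)
    also have "\<dots> = (a + b) powr p"
      using 3 by (simp flip: add_divide_distrib)
    finally have "(\<integral>x. \<bar>f x + g x\<bar> powr p \<partial>M) powr (1 / p) \<le> ((a + b) powr p) powr (1 / p)"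
      using p by (intro powr_mono2) (auto intro: integral_nonneg_AE)
    then show ?thesis
      using 3 p by (simp add: powr_powr)
  qed
  then show ?L by (simp add: a_def b_def)
qed

section \<open>The area measure\<close>

lemma vector_3_eq: "(vector [a, b, c] :: real^3) = a *\<^sub>R axis 1 1 + b *\<^sub>R axis 2 1 + c *\<^sub>R axis 3 1"
  by (simp add: vec_eq_iff forall_3 axis_def)

lemma spherical_coords_in_S2: "spherical_coords z \<in> S2"
proof (cases z)
  case (Pair \<phi> \<theta>)
  have "(cos \<theta> * cos \<phi>)\<^sup>2 + (cos \<theta> * sin \<phi>)\<^sup>2 + (sin \<theta>)\<^sup>2
    = (cos \<theta>)\<^sup>2 * ((cos \<phi>)\<^sup>2 + (sin \<phi>)\<^sup>2) + (sin \<theta>)\<^sup>2"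
    by (simp only: power_mult_distrib distrib_left)
  also have "\<dots> = 1" by simp
  finally show ?thesis
    by (simp add: Pair spherical_coords_def norm_eq_1 inner_vec_def sum_3 power2_eq_square)
qed

lemma spherical_coords_borel: "spherical_coords \<in> borel_measurable borel"
proof (rule borel_measurable_continuous_onI)
  have "spherical_coords = (\<lambda>z. (cos (snd z) * cos (fst z)) *\<^sub>R axis 1 1
      + (cos (snd z) * sin (fst z)) *\<^sub>R axis 2 1 + sin (snd z) *\<^sub>R axis 3 1)"
    by (auto simp: spherical_coords_def vector_3_eq)
  moreover have "continuous_on UNIV \<dots>" by (intro continuous_intros)
  ultimately show "continuous_on UNIV spherical_coords" by (simp only:)
qed

lemma space_area [simp]: "space area = S2"
  by (simp add: area_def space_restrict_space)

lemma sets_area: "sets area = sets (restrict_space borel S2)"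
  by (simp add: area_def)

lemma spherical_density_borel:
  "(\<lambda>(\<phi>, \<theta>). indicator ({-pi<..pi} \<times> {-(pi/2)..pi/2}) (\<phi>, \<theta>) * ennreal (cos \<theta>)) \<in> borel_measurable borel"
proof -
  have "(\<lambda>z::real \<times> real. indicator ({-pi<..pi} \<times> {-(pi/2)..pi/2}) z * ennreal (cos (snd z))) \<in> borel_measurable borel"
  proof (rule borel_measurable_times_ennreal)
    show "(\<lambda>z::real \<times> real. ennreal (cos (snd z))) \<in> borel_measurable borel"
      by (intro measurable_compose[OF _ measurable_ennreal] borel_measurable_continuous_onI continuous_intros)
  qed (intro borel_measurable_indicator borel_Times; simp)
  then show ?thesis by (simp add: case_prod_unfold)
qed

lemma emeasure_area:
  assumes "A \<in> sets area"
  shows "emeasure area A = (\<integral>\<^sup>+ (\<phi>, \<theta>). indicator ({-pi<..pi} \<times> {-(pi/2)..pi/2}) (\<phi>, \<theta>) * ennreal (cos \<theta>)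
      * indicator A (spherical_coords (\<phi>, \<theta>)) \<partial>lborel)"
proof -
  let ?d = "\<lambda>(\<phi>, \<theta>). indicator ({-pi<..pi} \<times> {-(pi/2)..pi/2}) (\<phi>, \<theta>) * ennreal (cos \<theta>)"
  have m: "spherical_coords \<in> density lborel ?d \<rightarrow>\<^sub>M restrict_space borel S2"
    using spherical_coords_borel spherical_coords_in_S2 by (intro measurable_restrict_space2) auto
  have "A \<in> sets (restrict_space borel S2)" using assms by (simp add: sets_area)
  then have "emeasure area A = emeasure (density lborel ?d) (spherical_coords -` A)"
    unfolding area_def by (subst emeasure_distr[OF m]) auto
  also have "\<dots> = (\<integral>\<^sup>+ z. ?d z * indicator (spherical_coords -` A) z \<partial>lborel)"
    using measurable_sets[OF m \<open>A \<in> sets (restrict_space borel S2)\<close>] spherical_density_borel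
    by (intro emeasure_density) auto
  finally show ?thesis by (simp add: case_prod_unfold indicator_def)
qed

lemma finite_measure_area: "finite_measure area"
proof (rule finite_measureI)
  have "emeasure area (space area) \<le> (\<integral>\<^sup>+ z. indicator ({-pi<..pi} \<times> {-(pi/2)..pi/2}) z \<partial>lborel)"
    by (subst emeasure_area, rule sets.top)
      (auto simp: case_prod_unfold indicator_def spherical_coords_in_S2[simplified] intro!: nn_integral_mono)
  also have "\<dots> = emeasure lborel ({-pi<..pi} \<times> {-(pi/2)..pi/2})"
    by (intro nn_integral_indicator) (auto intro: borel_Times)
  also have "\<dots> = emeasure (lborel \<Otimes>\<^sub>M lborel) ({-pi<..pi} \<times> {-(pi/2)..pi/2})"
    by (simp add: lborel_prod)
  also have "\<dots> = emeasure lborel {-pi<..pi} * emeasure lborel {-(pi/2)..pi/2}"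
    by (intro lborel.emeasure_pair_measure_Times) auto
  also have "\<dots> < \<infinity>"
    by (simp add: ennreal_mult_less_top)
  finally show "emeasure area (space area) \<noteq> \<infinity>" by simp
qed

interpretation area: finite_measure area
  by (rule finite_measure_area)

lemma borel_measurable_area:
  fixes f :: "real^3 \<Rightarrow> 'b::topological_space"
  shows "continuous_on S2 f \<Longrightarrow> f \<in> borel_measurable area"
  using borel_measurable_continuous_on_restrict by (simp add: measurable_cong_sets[OF sets_area refl])

lemma integrable_area_continuous:
  fixes f :: "real^3 \<Rightarrow> real"
  assumes "continuous_on S2 f"
  shows "integrable area f"
proof -
  have "bounded (f ` S2)"
    by (intro compact_imp_bounded compact_continuous_image assms) simp
  then obtain B where "\<And>x. x \<in> S2 \<Longrightarrow> norm (f x) \<le> B" unfolding bounded_iff by blast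
  then show ?thesis
    by (intro area.integrable_const_bound[of _ B] borel_measurable_area assms AE_I2) simp
qed

text \<open>In the coordinate rectangle this set lies on the line
  \<open>\<theta> = arcsin c\<close>, which is null for planar Lebesgue measure. It makes
  \<open>x $ 3\<close> the variable without atoms that the followers require.\<close>

lemma measure_area_latitude: "measure area {x \<in> space area. x $ 3 = c} = 0"
proof -
  have [measurable]: "(\<lambda>x::real^3. x $ 3) \<in> borel_measurable area"
    by (intro borel_measurable_area continuous_intros)
  have "AE z in lborel. z \<notin> (UNIV :: real set) \<times> {arcsin c}"
  proof (rule AE_not_in, rule null_setsI)
    have "emeasure (lborel \<Otimes>\<^sub>M lborel) ((UNIV :: real set) \<times> {arcsin c}) = 0"
      by (subst lborel.emeasure_pair_measure_Times) auto
    then show "emeasure lborel ((UNIV :: real set) \<times> {arcsin c}) = 0" by (simp add: lborel_prod)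
  qed (auto intro: borel_Times)
  then have "AE z in lborel. (case z of (\<phi>, \<theta>) \<Rightarrow>
     indicator ({-pi<..pi} \<times> {-(pi/2)..pi/2}) (\<phi>, \<theta>) * ennreal (cos \<theta>)
      * indicator {x \<in> space area. x $ 3 = c} (spherical_coords (\<phi>, \<theta>))) = 0"
  proof eventually_elim
    case (elim z)
    have "arcsin (sin (snd z)) = snd z" if "-(pi/2) \<le> snd z" "snd z \<le> pi/2"
      using that by (intro arcsin_sin)
    then show ?case
      using elim by (cases z) (auto simp: indicator_def spherical_coords_def)
  qed
  then have "emeasure area {x \<in> space area. x $ 3 = c} = (\<integral>\<^sup>+ z. 0 \<partial>(lborel :: (real \<times> real) measure))"
    by (subst emeasure_area) (measurable, rule nn_integral_cong_AE)
  then show ?thesis by (simp add: measure_def)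
qed

section \<open>Followers\<close>

text \<open>The integers \<open>k\<close> and \<open>l\<close> number the cells of width
  \<open>e\<close> that contain \<open>g\<close> and \<open>h\<close>. Equal laws of
  \<open>g\<close> and \<open>h\<close> give cells of equal measure, so some \<open>f'\<close> makes
  \<open>(l, f')\<close> distributed like \<open>(k, f)\<close>. Then \<open>e * l\<close> is
  exactly as far from \<open>f'\<close> as \<open>e * k\<close> is from \<open>f\<close>, and
  replacing \<open>e * k\<close> by \<open>g\<close> and \<open>e * l\<close> by \<open>h\<close>
  costs at most \<open>e * c\<close> each.\<close>

lemma (in finite_measure) exists_follower:
  fixes f g h V :: "'a \<Rightarrow> real"
  assumes p: "1 \<le> p"
    and f[measurable]: "f \<in> borel_measurable M" and fi: "integrable M (\<lambda>x. \<bar>f x\<bar> powr p)"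
    and g[measurable]: "g \<in> borel_measurable M" and gi: "integrable M (\<lambda>x. \<bar>g x\<bar> powr p)"
    and h[measurable]: "h \<in> borel_measurable M"
    and gh: "distr M borel g = distr M borel h"
    and V: "V \<in> borel_measurable M" "\<And>c. measure M {x \<in> space M. V x = c} = 0"
    and \<eta>: "0 < \<eta>"
  obtains f' where "f' \<in> borel_measurable M" "distr M borel f' = distr M borel f"
    "(\<integral>x. \<bar>h x - f' x\<bar> powr p \<partial>M) powr (1 / p) \<le> (\<integral>x. \<bar>g x - f x\<bar> powr p \<partial>M) powr (1 / p) + \<eta>"
proof -
  define c where "c = measure M (space M) powr (1 / p)"
  \<comment> \<open>Two rounding errors of size \<open>e * c\<close> must fit into
    \<open>\<eta>\<close>; the summand 1 keeps the denominator positive even if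
    \<open>c = 0\<close>.\<close>
  define e where "e = \<eta> / (2 * c + 1)"
  have c: "0 \<le> c" and e: "0 < e" "2 * (e * c) \<le> \<eta>"
    using \<eta> by (auto simp: c_def e_def field_simps add_pos_nonneg intro!: divide_pos_pos)
  define k where "k x = \<lfloor>g x / e\<rfloor>" for x
  define l where "l x = \<lfloor>h x / e\<rfloor>" for x
  have [measurable]: "k \<in> measurable M (count_space UNIV)" "l \<in> measurable M (count_space UNIV)"
    unfolding k_def l_def by measurable
  have same: "measure M {x \<in> space M. k x = j} = measure M {x \<in> space M. l x = j}" for j
  proof -
    have "{y. \<lfloor>y / e\<rfloor> = j} \<in> sets borel" by measurable
    then have "measure (distr M borel g) {y. \<lfloor>y / e\<rfloor> = j} = measure M {x \<in> space M. k x = j}"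
      "measure (distr M borel h) {y. \<lfloor>y / e\<rfloor> = j} = measure M {x \<in> space M. l x = j}"
      by (auto simp: measure_distr k_def l_def intro!: arg_cong[where f="measure M"])
    then show ?thesis by (simp add: gh)
  qed
  obtain f' where f'[measurable]: "f' \<in> borel_measurable M"
    and law: "distr M (count_space UNIV \<Otimes>\<^sub>M borel) (\<lambda>x. (l x, f' x))
       = distr M (count_space UNIV \<Otimes>\<^sub>M borel) (\<lambda>x. (k x, f x))"
    by (rule exists_equal_joint_law[of f V k l]) (use f V same in auto)
  have law_f: "distr M borel f' = distr M borel f"
  proof -
    have "distr (distr M (count_space UNIV \<Otimes>\<^sub>M borel) (\<lambda>x. (l x, f' x))) borel snd = distr M borel f'"
      by (subst distr_distr) (auto simp: comp_def)
    moreover have "distr (distr M (count_space UNIV \<Otimes>\<^sub>M borel) (\<lambda>x. (k x, f x))) borel snd = distr M borel f"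
      by (subst distr_distr) (auto simp: comp_def)
    ultimately show ?thesis by (simp add: law)
  qed
  \<comment> \<open>The cost depends on the pair (cell, value) alone, so its integral is determined
    by the joint law.\<close>
  define \<Phi> where "\<Phi> = (\<lambda>(j::int, s::real). \<bar>e * j - s\<bar> powr p)"
  have \<Phi>[measurable]: "\<Phi> \<in> borel_measurable (count_space UNIV \<Otimes>\<^sub>M borel)"
    unfolding \<Phi>_def by measurable
  have close: "\<bar>e * k x - g x\<bar> \<le> e" "\<bar>h x - e * l x\<bar> \<le> e" for x
  proof -
    have "\<bar>e * \<lfloor>y / e\<rfloor> - y\<bar> \<le> e" for y
    proof -
      have "e * \<lfloor>y / e\<rfloor> \<le> e * (y / e)" "e * (y / e) \<le> e * (\<lfloor>y / e\<rfloor> + 1)"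
        using e by (intro mult_left_mono; linarith)+
      then show ?thesis using e by (simp add: abs_le_iff distrib_left)
    qed
    from this[of "g x"] this[of "h x"] show "\<bar>e * k x - g x\<bar> \<le> e" "\<bar>h x - e * l x\<bar> \<le> e"
      by (simp_all add: k_def l_def abs_minus_commute)
  qed
  have small: "integrable M (\<lambda>x. \<bar>u x\<bar> powr p)" "(\<integral>x. \<bar>u x\<bar> powr p \<partial>M) powr (1 / p) \<le> e * c"
    if [measurable]: "u \<in> borel_measurable M" and u: "\<And>x. \<bar>u x\<bar> \<le> e" for u :: "'a \<Rightarrow> real"
  proof -
    have up: "\<bar>u x\<bar> powr p \<le> e powr p" for x using u p by (intro powr_mono2) auto
    then show i: "integrable M (\<lambda>x. \<bar>u x\<bar> powr p)"
      by (intro integrable_const_bound[of _ "e powr p"]) auto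
    have "(\<integral>x. \<bar>u x\<bar> powr p \<partial>M) \<le> (\<integral>x. e powr p \<partial>M)"
      using i up by (intro integral_mono) auto
    then have "(\<integral>x. \<bar>u x\<bar> powr p \<partial>M) powr (1 / p) \<le> (e powr p * measure M (space M)) powr (1 / p)"
      using p by (intro powr_mono2) (auto intro: integral_nonneg_AE simp: mult.commute)
    also have "\<dots> = e * c"
      using e p by (simp add: powr_mult powr_powr c_def)
    finally show "(\<integral>x. \<bar>u x\<bar> powr p \<partial>M) powr (1 / p) \<le> e * c" .
  qed
  have neg_fi: "integrable M (\<lambda>x. \<bar>- f x\<bar> powr p)" using fi by simp
  have gf: "integrable M (\<lambda>x. \<bar>g x + - f x\<bar> powr p)"
    by (rule Minkowski_inequality(1)[OF p g gi _ neg_fi]) measurable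
  note kg = small[of "\<lambda>x. e * k x - g x", OF _ close(1)]
  note hl = small[of "\<lambda>x. h x - e * l x", OF _ close(2)]
  have kf: "integrable M (\<lambda>x. \<bar>(e * k x - g x) + (g x + - f x)\<bar> powr p)"
    "(\<integral>x. \<bar>(e * k x - g x) + (g x + - f x)\<bar> powr p \<partial>M) powr (1 / p)
     \<le> (\<integral>x. \<bar>e * k x - g x\<bar> powr p \<partial>M) powr (1 / p) + (\<integral>x. \<bar>g x + - f x\<bar> powr p \<partial>M) powr (1 / p)"
    by (rule Minkowski_inequality[OF p _ kg(1) _ gf]; measurable)+
  then have kf: "integrable M (\<lambda>x. \<Phi> (k x, f x))"
    "(\<integral>x. \<Phi> (k x, f x) \<partial>M) powr (1 / p) \<le> e * c + (\<integral>x. \<bar>g x - f x\<bar> powr p \<partial>M) powr (1 / p)"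
    using kg(2) by (auto simp: \<Phi>_def)
  have "integrable (distr M (count_space UNIV \<Otimes>\<^sub>M borel) (\<lambda>x. (l x, f' x))) \<Phi>"
    unfolding law using kf(1) by (subst integrable_distr_eq) auto
  then have lf_int: "integrable M (\<lambda>x. \<Phi> (l x, f' x))"
    by (subst (asm) integrable_distr_eq) auto
  have "(\<integral>x. \<Phi> (l x, f' x) \<partial>M) = integral\<^sup>L (distr M (count_space UNIV \<Otimes>\<^sub>M borel) (\<lambda>x. (l x, f' x))) \<Phi>"
    by (subst integral_distr) auto
  also have "\<dots> = (\<integral>x. \<Phi> (k x, f x) \<partial>M)"
    unfolding law by (subst integral_distr) auto
  finally have lf: "(\<integral>x. \<Phi> (l x, f' x) \<partial>M) = (\<integral>x. \<Phi> (k x, f x) \<partial>M)" .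
  have "(\<integral>x. \<bar>(h x - e * l x) + (e * l x - f' x)\<bar> powr p \<partial>M) powr (1 / p)
     \<le> (\<integral>x. \<bar>h x - e * l x\<bar> powr p \<partial>M) powr (1 / p) + (\<integral>x. \<bar>e * l x - f' x\<bar> powr p \<partial>M) powr (1 / p)"
    using lf_int by (intro Minkowski_inequality[OF p _ hl(1)]) (auto simp: \<Phi>_def)
  then have "(\<integral>x. \<bar>h x - f' x\<bar> powr p \<partial>M) powr (1 / p) \<le> e * c + (\<integral>x. \<Phi> (l x, f' x) \<partial>M) powr (1 / p)"
    using hl(2) by (simp add: \<Phi>_def)
  also have "\<dots> \<le> (\<integral>x. \<bar>g x - f x\<bar> powr p \<partial>M) powr (1 / p) + \<eta>"
    using kf(2) e(2) unfolding lf by simp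
  finally show thesis using f' law_f that by blast
qed

text \<open>Open upper half-lines determine a finite Borel measure on the line. In this form being a
  rearrangement is visibly an equivalence relation, and integrals of functions of the value carry
  over.\<close>

lemma rearrangements_eq_distr:
  assumes f: "f \<in> borel_measurable area"
  shows "rearrangements f = {g \<in> borel_measurable area. distr area borel g = distr area borel f}"
proof -
  have em: "emeasure (distr area borel u) {s<..} = emeasure area {x \<in> space area. u x > s}"
    if "u \<in> borel_measurable area" for u :: "real^3 \<Rightarrow> real" and s
    using that by (subst emeasure_distr) (auto intro!: arg_cong[where f="emeasure area"])
  have "distr area borel g = distr area borel f"
    if g: "g \<in> borel_measurable area"
      and "\<And>s. emeasure area {x \<in> space area. g x > s} = emeasure area {x \<in> space area. f x > s}" for g
    by (rule measure_eqI_lessThan) (use that f area.emeasure_finite in \<open>auto simp: em less_top[symmetric]\<close>)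
  moreover have "emeasure area {x \<in> space area. g x > s} = emeasure area {x \<in> space area. f x > s}"
    if "g \<in> borel_measurable area" "distr area borel g = distr area borel f" for g s
    using em[OF that(1), of s] em[OF f, of s] that(2) by simp
  ultimately show ?thesis unfolding rearrangements_def by blast
qed

section \<open>Smooth functions\<close>

text \<open>\<open>frechet_derivative\<close> is a choice among the maps satisfying
  \<open>has_derivative\<close>, and that predicate is local.\<close>

lemma frechet_derivative_cong_open:
  assumes "open U" "x \<in> U" "\<And>y. y \<in> U \<Longrightarrow> f y = g y"
  shows "frechet_derivative f (at x) = frechet_derivative g (at x)"
proof -
  have "(f has_derivative D) (at x) \<longleftrightarrow> (g has_derivative D) (at x)" for D
    using has_derivative_transform_within_open[OF _ assms(1,2), of f D UNIV g]
      has_derivative_transform_within_open[OF _ assms(1,2), of g D UNIV f] assms(3)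
    by auto
  then show ?thesis by (simp add: frechet_derivative_def)
qed

lemma frechet_derivativeI: "(f has_derivative D) (at x) \<Longrightarrow> frechet_derivative f (at x) = D"
  using frechet_derivative_at by metis

lemma differentiable_on_openD:
  "f differentiable_on U \<Longrightarrow> open U \<Longrightarrow> x \<in> U \<Longrightarrow> (f has_derivative frechet_derivative f (at x)) (at x)"
  using differentiable_on_eq_differentiable_at frechet_derivative_works by blast

lemma Ck_on_cong:
  fixes f g :: "'a::euclidean_space \<Rightarrow> 'b::real_normed_vector"
  assumes "open U" "\<And>x. x \<in> U \<Longrightarrow> f x = g x"
  shows "Ck_on k f U \<longleftrightarrow> Ck_on k g U"
  using assms(2)
proof (induction k arbitrary: f g)
  case 0
  then show ?case by (simp cong: continuous_on_cong)
next
  case (Suc k)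
  have "f differentiable_on U \<longleftrightarrow> g differentiable_on U"
    unfolding differentiable_on_def differentiable_def
    by (metis Suc.prems has_derivative_transform)
  moreover have "Ck_on k (\<lambda>x. frechet_derivative f (at x) b) U \<longleftrightarrow> Ck_on k (\<lambda>x. frechet_derivative g (at x) b) U" for b
    by (rule Suc.IH) (simp add: frechet_derivative_cong_open[OF assms(1) _ Suc.prems])
  ultimately show ?case by simp
qed

lemma Ck_on_SucD:
  fixes f :: "'a::euclidean_space \<Rightarrow> 'b::real_normed_vector"
  shows "Ck_on (Suc k) f U \<Longrightarrow> Ck_on k f U"
proof (induction k arbitrary: f)
  case 0
  then show ?case by (simp add: differentiable_imp_continuous_on)
next
  case (Suc k)
  have "f differentiable_on U" using Suc.prems by simp
  moreover have "Ck_on k (\<lambda>x. frechet_derivative f (at x) b) U" if "b \<in> Basis" for b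
    by (rule Suc.IH) (use Suc.prems that in simp)
  ultimately show ?case by simp
qed

lemma Ck_on_const: "Ck_on k (\<lambda>x::'a::euclidean_space. c :: 'b::real_normed_vector) U"
  by (induction k arbitrary: c) (auto simp: frechet_derivative_const)

lemma Ck_on_id: "Ck_on k (\<lambda>x::'a::euclidean_space. x) U"
  by (cases k) (auto simp: Ck_on_const frechet_derivative_ident)

lemma Ck_on_add:
  fixes f g :: "'a::euclidean_space \<Rightarrow> 'b::real_normed_vector"
  assumes "open U"
  shows "Ck_on k f U \<Longrightarrow> Ck_on k g U \<Longrightarrow> Ck_on k (\<lambda>x. f x + g x) U"
proof (induction k arbitrary: f g)
  case 0
  then show ?case by (simp add: continuous_on_add)
next
  case (Suc k)
  have fg: "f differentiable_on U" "g differentiable_on U" using Suc.prems by simp_all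
  have "Ck_on k (\<lambda>x. frechet_derivative (\<lambda>x. f x + g x) (at x) b) U" if b: "b \<in> Basis" for b
  proof -
    have "frechet_derivative (\<lambda>x. f x + g x) (at x) b = frechet_derivative f (at x) b + frechet_derivative g (at x) b"
      if "x \<in> U" for x
      using frechet_derivativeI[OF has_derivative_add[OF differentiable_on_openD[OF fg(1) assms that]
        differentiable_on_openD[OF fg(2) assms that]]] by simp
    moreover have "Ck_on k (\<lambda>x. frechet_derivative f (at x) b + frechet_derivative g (at x) b) U"
      using Suc.prems b by (intro Suc.IH) auto
    ultimately show ?thesis
      by (subst Ck_on_cong[OF assms, where g="\<lambda>x. frechet_derivative f (at x) b + frechet_derivative g (at x) b"]) auto
  qed
  then show ?case using differentiable_on_add[OF fg] by simp
qed

lemma Ck_on_sum: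
  fixes f :: "'i \<Rightarrow> 'a::euclidean_space \<Rightarrow> 'b::real_normed_vector"
  assumes "open U" "\<And>i. i \<in> I \<Longrightarrow> Ck_on k (f i) U"
  shows "Ck_on k (\<lambda>x. \<Sum>i\<in>I. f i x) U"
  using assms(2)
  by (induction I rule: infinite_finite_induct) (auto simp: Ck_on_const intro: Ck_on_add[OF assms(1)])

text \<open>Stated for a bounded bilinear map so as to serve powers, scalar multiples and cross
  products alike. In each term of the product rule one factor stays undifferentiated, so its order
  is lowered by \<open>Ck_on_SucD\<close> before the induction hypothesis applies.\<close>

lemma (in bounded_bilinear) Ck_on_prod:
  fixes f :: "'d::euclidean_space \<Rightarrow> 'a" and g :: "'d \<Rightarrow> 'b"
  assumes "open U"
  shows "Ck_on k f U \<Longrightarrow> Ck_on k g U \<Longrightarrow> Ck_on k (\<lambda>x. prod (f x) (g x)) U"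
proof (induction k arbitrary: f g)
  case 0
  then show ?case by (simp add: continuous_on)
next
  case (Suc k)
  have fg: "f differentiable_on U" "g differentiable_on U" using Suc.prems by simp_all
  have D: "((\<lambda>x. prod (f x) (g x)) has_derivative
      (\<lambda>h. prod (f x) (frechet_derivative g (at x) h) + prod (frechet_derivative f (at x) h) (g x))) (at x)"
    if "x \<in> U" for x
    by (rule FDERIV[OF differentiable_on_openD[OF fg(1) assms that] differentiable_on_openD[OF fg(2) assms that]])
  then have "(\<lambda>x. prod (f x) (g x)) differentiable_on U"
    using assms differentiable_on_eq_differentiable_at differentiable_def by blast
  moreover have "Ck_on k (\<lambda>x. frechet_derivative (\<lambda>x. prod (f x) (g x)) (at x) b) U" if b: "b \<in> Basis" for b
  proof -
    have "Ck_on k (\<lambda>x. prod (f x) (frechet_derivative g (at x) b) + prod (frechet_derivative f (at x) b) (g x)) U"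
      by (intro Ck_on_add assms Suc.IH) (use Suc.prems b Ck_on_SucD[OF Suc.prems(1)] Ck_on_SucD[OF Suc.prems(2)] in auto)
    then show ?thesis
      by (subst Ck_on_cong[OF assms]) (auto simp: frechet_derivativeI[OF D])
  qed
  ultimately show ?case by simp
qed

lemma Ck_on_power:
  fixes f :: "'a::euclidean_space \<Rightarrow> real"
  assumes "open U" "Ck_on k f U"
  shows "Ck_on k (\<lambda>x. f x ^ n) U"
  by (induction n)
    (auto simp: Ck_on_const intro: bounded_bilinear.Ck_on_prod[OF bounded_bilinear_mult assms(1)] assms(2))

text \<open>Turns an extension of a solution to a neighbourhood of space-time into an extension of
  \<open>\<zeta> t\<close> near the sphere. The derivative along \<open>b\<close> is that of
  \<open>G\<close> along the basis vector \<open>(b, 0)\<close>.\<close>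

lemma Ck_on_slice:
  fixes G :: "'a::euclidean_space \<times> 'b::euclidean_space \<Rightarrow> 'c::real_normed_vector"
  assumes "open U"
  shows "Ck_on k G U \<Longrightarrow> Ck_on k (\<lambda>x. G (x, t)) {x. (x, t) \<in> U}"
proof (induction k arbitrary: G)
  case 0
  then show ?case
    by (auto intro!: continuous_on_compose2[of U G] continuous_intros)
next
  case (Suc k)
  let ?V = "{x. (x, t) \<in> U}"
  have V: "open ?V"
    using open_vimage[OF assms, of "\<lambda>x. (x, t)"] by (simp add: vimage_def continuous_on_Pair)
  have D: "((\<lambda>x. G (x, t)) has_derivative (\<lambda>h. frechet_derivative G (at (x, t)) (h, 0))) (at x)"
    if "x \<in> ?V" for x
  proof -
    have "(G has_derivative frechet_derivative G (at (x, t))) (at (x, t))"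
      using Suc.prems that by (intro differentiable_on_openD[OF _ assms]) auto
    then show ?thesis
      by (rule has_derivative_compose[rotated, where f="\<lambda>x. (x, t)"])
        (auto intro!: derivative_eq_intros)
  qed
  then have "(\<lambda>x. G (x, t)) differentiable_on ?V"
    using V differentiable_on_eq_differentiable_at differentiable_def by blast
  moreover have "Ck_on k (\<lambda>x. frechet_derivative (\<lambda>x. G (x, t)) (at x) b) ?V" if b: "b \<in> Basis" for b
  proof -
    have "(b, 0) \<in> (Basis :: ('a \<times> 'b) set)" using b by (simp add: Basis_prod_def)
    then have "Ck_on k (\<lambda>x. frechet_derivative G (at (x, t)) (b, 0)) ?V"
      using Suc.prems by (intro Suc.IH[of "\<lambda>z. frechet_derivative G (at z) (b, 0)"]) auto
    then show ?thesis
      by (subst Ck_on_cong[OF V]) (auto simp: frechet_derivativeI[OF D])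
  qed
  ultimately show ?case by simp
qed

section \<open>Symmetry of second derivatives\<close>

text \<open>The mean value theorem is used twice: along \<open>a\<close> for the increment of
  \<open>g\<close> over a step in direction \<open>b\<close>, then along \<open>b\<close> for the
  derivative in direction \<open>a\<close>.\<close>

lemma second_difference_mean_value:
  fixes g :: "'a::euclidean_space \<Rightarrow> real"
  assumes U: "open U" and g: "g differentiable_on U" and ga: "(\<lambda>x. frechet_derivative g (at x) a) differentiable_on U"
    and h: "0 < h" and near: "\<And>s t. 0 \<le> s \<Longrightarrow> s \<le> h \<Longrightarrow> 0 \<le> t \<Longrightarrow> t \<le> h \<Longrightarrow> x + s *\<^sub>R a + t *\<^sub>R b \<in> U"
  obtains s t where "0 \<le> s" "s \<le> h" "0 \<le> t" "t \<le> h"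
    "g (x + h *\<^sub>R a + h *\<^sub>R b) - g (x + h *\<^sub>R a) - g (x + h *\<^sub>R b) + g x
      = h * h * frechet_derivative (\<lambda>y. frechet_derivative g (at y) a) (at (x + s *\<^sub>R a + t *\<^sub>R b)) b"
proof -
  let ?ga = "\<lambda>y. frechet_derivative g (at y) a"
  let ?p = "\<lambda>s t. x + s *\<^sub>R a + t *\<^sub>R b"
  have D: "((\<lambda>s. g (?p s t)) has_real_derivative ?ga (?p s t)) (at s)"
    if "0 \<le> s" "s \<le> h" "0 \<le> t" "t \<le> h" for s t
  proof -
    have d: "(g has_derivative frechet_derivative g (at (?p s t))) (at (?p s t))"
      by (rule differentiable_on_openD[OF g U near]) (use that in auto)
    have "((\<lambda>s. g (?p s t)) has_derivative (\<lambda>r. frechet_derivative g (at (?p s t)) (r *\<^sub>R a))) (at s)"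
      by (rule has_derivative_compose[where f="\<lambda>s. ?p s t" and g=g, OF _ d]) (auto intro!: derivative_eq_intros)
    then show ?thesis
      by (simp add: has_field_derivative_def linear_cmul[OF has_derivative_linear[OF d]] mult_commute_abs)
  qed
  have D2: "((\<lambda>t. ?ga (?p s t)) has_real_derivative frechet_derivative ?ga (at (?p s t)) b) (at t)"
    if "0 \<le> s" "s \<le> h" "0 \<le> t" "t \<le> h" for s t
  proof -
    have d: "(?ga has_derivative frechet_derivative ?ga (at (?p s t))) (at (?p s t))"
      by (rule differentiable_on_openD[OF ga U near]) (use that in auto)
    have "((\<lambda>t. ?ga (?p s t)) has_derivative (\<lambda>r. frechet_derivative ?ga (at (?p s t)) (r *\<^sub>R b))) (at t)"
      by (rule has_derivative_compose[where f="\<lambda>t. ?p s t" and g="?ga", OF _ d]) (auto intro!: derivative_eq_intros)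
    then show ?thesis
      by (simp add: has_field_derivative_def linear_cmul[OF has_derivative_linear[OF d]] mult_commute_abs)
  qed
  obtain s where s: "0 < s" "s < h"
    "(g (?p h h) - g (?p h 0)) - (g (?p 0 h) - g (?p 0 0)) = (h - 0) * (?ga (?p s h) - ?ga (?p s 0))"
  proof -
    have "((\<lambda>s. g (?p s h) - g (?p s 0)) has_real_derivative ?ga (?p s h) - ?ga (?p s 0)) (at s)"
      if "0 \<le> s" "s \<le> h" for s
      by (intro DERIV_diff D) (use that h in auto)
    from MVT2[OF h this] obtain s where "0 < s" "s < h"
      "(g (?p h h) - g (?p h 0)) - (g (?p 0 h) - g (?p 0 0)) = (h - 0) * (?ga (?p s h) - ?ga (?p s 0))"
      by blast
    then show thesis by (rule that)
  qed
  obtain t where t: "0 < t" "t < h" "?ga (?p s h) - ?ga (?p s 0) = (h - 0) * frechet_derivative ?ga (at (?p s t)) b"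
    using MVT2[OF h, of "\<lambda>t. ?ga (?p s t)" "\<lambda>t. frechet_derivative ?ga (at (?p s t)) b"] D2[of s] s by auto
  show thesis
    by (rule that[of s t]) (use s t in \<open>simp_all add: algebra_simps\<close>)
qed

text \<open>The second difference is symmetric in \<open>a\<close> and \<open>b\<close>; divided by
  the squared step it tends to one mixed derivative or to the other, according to the order in which
  the mean value theorem is applied. Continuity of both at \<open>x\<close> identifies the
  limits.\<close>

lemma mixed_partials_commute:
  fixes g :: "'a::euclidean_space \<Rightarrow> real"
  assumes U: "open U" "x \<in> U" and g: "Ck_on 2 g U" and ab: "a \<in> Basis" "b \<in> Basis"
  shows "frechet_derivative (\<lambda>y. frechet_derivative g (at y) a) (at x) b
       = frechet_derivative (\<lambda>y. frechet_derivative g (at y) b) (at x) a"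
proof -
  let ?H = "\<lambda>a b y. frechet_derivative (\<lambda>y. frechet_derivative g (at y) a) (at y) b"
  have g1: "g differentiable_on U"
    and g2: "(\<lambda>y. frechet_derivative g (at y) c) differentiable_on U"
    and g3: "continuous_on U (?H c d)" if "c \<in> Basis" "d \<in> Basis" for c d
    using g that by (simp_all add: numeral_2_eq_2)
  obtain r where r: "0 < r" "ball x r \<subseteq> U" using U by (auto simp: open_contains_ball)
  \<comment> \<open>Each point that occurs is within \<open>2 * h n\<close> of \<open>x\<close>, and
    \<open>h n \<le> r / 3\<close> keeps it in the ball.\<close>
  define h where "h n = r / 3 / real (Suc n)" for n
  have h0: "0 < h n" "h n \<le> r / 3" for n using r by (simp_all add: h_def field_simps)
  have dist: "dist x (x + s *\<^sub>R c + t *\<^sub>R d) \<le> 2 * h n"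
    if "c \<in> Basis" "d \<in> Basis" "0 \<le> s" "s \<le> h n" "0 \<le> t" "t \<le> h n" for s t n and c d :: 'a
  proof -
    have "dist x (x + s *\<^sub>R c + t *\<^sub>R d) = norm (s *\<^sub>R c + t *\<^sub>R d)"
      by (metis add.assoc add_diff_cancel_left' dist_norm norm_minus_commute)
    also have "\<dots> \<le> s + t"
      using norm_triangle_ineq[of "s *\<^sub>R c" "t *\<^sub>R d"] that by simp
    finally show ?thesis using that by simp
  qed
  have near: "x + s *\<^sub>R c + t *\<^sub>R d \<in> U"
    if "c \<in> Basis" "d \<in> Basis" "0 \<le> s" "s \<le> h n" "0 \<le> t" "t \<le> h n" for s t n and c d :: 'a
    using dist[OF that] h0[of n] r by (auto simp: subset_eq)
  have lim: "\<exists>z. z \<longlonglongrightarrow> ?H c d x \<and> (\<forall>n. g (x + h n *\<^sub>R c + h n *\<^sub>R d) - g (x + h n *\<^sub>R c) - g (x + h n *\<^sub>R d) + g x = h n * h n * z n)"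
    if cd: "c \<in> Basis" "d \<in> Basis" for c d
  proof -
    have "\<exists>y. dist x y \<le> 2 * h n \<and> g (x + h n *\<^sub>R c + h n *\<^sub>R d) - g (x + h n *\<^sub>R c) - g (x + h n *\<^sub>R d) + g x = h n * h n * ?H c d y" for n
      by (rule second_difference_mean_value[OF U(1) g1[OF cd] g2[OF cd] h0(1)[of n], of x d])
        (use near cd dist in blast)+
    then obtain y where y: "\<And>n. dist x (y n) \<le> 2 * h n"
      "\<And>n. g (x + h n *\<^sub>R c + h n *\<^sub>R d) - g (x + h n *\<^sub>R c) - g (x + h n *\<^sub>R d) + g x = h n * h n * ?H c d (y n)"
      by metis
    have "(\<lambda>n. 2 * (r / 3 * (1 / real (Suc n)))) \<longlonglongrightarrow> 2 * (r / 3 * 0)"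
      by (intro tendsto_intros LIMSEQ_inverse_real_of_nat[unfolded inverse_eq_divide])
    then have "(\<lambda>n. 2 * h n) \<longlonglongrightarrow> 0" by (simp add: h_def)
    then have "(\<lambda>n. dist (y n) x) \<longlonglongrightarrow> 0"
      by (rule tendsto_sandwich[OF _ _ tendsto_const, rotated 2]) (auto simp: dist_commute y(1))
    then have "y \<longlonglongrightarrow> x" by (rule tendsto_dist_iff[THEN iffD2])
    moreover have "isCont (?H c d) x"
      using g3[OF cd] U by (simp add: continuous_on_eq_continuous_at)
    ultimately have "(\<lambda>n. ?H c d (y n)) \<longlonglongrightarrow> ?H c d x"
      by (rule isCont_tendsto_compose[rotated])
    with y(2) show ?thesis by blast
  qed
  obtain z where z: "z \<longlonglongrightarrow> ?H a b x" "\<And>n. g (x + h n *\<^sub>R a + h n *\<^sub>R b) - g (x + h n *\<^sub>R a) - g (x + h n *\<^sub>R b) + g x = h n * h n * z n"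
    using lim[OF ab] by blast
  obtain w where w: "w \<longlonglongrightarrow> ?H b a x" "\<And>n. g (x + h n *\<^sub>R b + h n *\<^sub>R a) - g (x + h n *\<^sub>R b) - g (x + h n *\<^sub>R a) + g x = h n * h n * w n"
    using lim[OF ab(2,1)] by blast
  have "z n = w n" for n
  proof -
    have eq: "x + h n *\<^sub>R b + h n *\<^sub>R a = x + h n *\<^sub>R a + h n *\<^sub>R b" by (simp add: algebra_simps)
    have "h n * h n * z n = h n * h n * w n"
      using z(2)[of n] w(2)[of n] unfolding eq by linarith
    then show ?thesis using h0(1)[of n] by simp
  qed
  then have "z = w" by auto
  then show ?thesis using LIMSEQ_unique z(1) w(1) by blast
qed

section \<open>The rotated gradient\<close>

text \<open>The gradient in the ambient space, radial part included. The form as a sum of scaled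
  axis vectors lets the sum rules for \<open>Ck_on\<close> and \<open>has_derivative\<close>
  apply.\<close>

definition egrad :: "(real^3 \<Rightarrow> real) \<Rightarrow> real^3 \<Rightarrow> real^3" where
  "egrad g y = (\<Sum>j\<in>UNIV. frechet_derivative g (at y) (axis j 1) *\<^sub>R axis j 1)"

lemma egrad_nth: "egrad g y $ i = frechet_derivative g (at y) (axis i 1)"
  by (simp add: egrad_def axis_def if_distrib cong: if_cong)

lemma linear_vec3_expand:
  fixes L :: "real^3 \<Rightarrow> real"
  assumes "linear L"
  shows "L v = v $ 1 * L (axis 1 1) + v $ 2 * L (axis 2 1) + v $ 3 * L (axis 3 1)"
proof -
  have "v = v $ 1 *\<^sub>R axis 1 1 + v $ 2 *\<^sub>R axis 2 1 + v $ 3 *\<^sub>R axis 3 1"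
    by (simp add: vec_eq_iff forall_3 axis_def)
  then have "L v = L (v $ 1 *\<^sub>R axis 1 1 + v $ 2 *\<^sub>R axis 2 1 + v $ 3 *\<^sub>R axis 3 1)" by simp
  also have "\<dots> = v $ 1 * L (axis 1 1) + v $ 2 * L (axis 2 1) + v $ 3 * L (axis 3 1)"
    by (simp add: linear_add[OF assms] linear_cmul[OF assms])
  finally show ?thesis .
qed

text \<open>At a unit vector the derivative of the normalisation is the orthogonal projection onto
  the tangent plane; this is why differentiating through \<open>sgn\<close> yields tangential
  derivatives.\<close>

lemma has_derivative_sgn_unit:
  fixes x :: "'a::real_inner"
  assumes "norm x = 1"
  shows "(sgn has_derivative (\<lambda>h. h - (x \<bullet> h) *\<^sub>R x)) (at x)"
proof -
  have x: "x \<noteq> 0" "norm x \<noteq> 0" "sgn x = x" using assms by (auto simp: sgn_div_norm)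
  have sgn: "sgn = (\<lambda>y::'a. inverse (norm y) *\<^sub>R y)"
    by (auto simp: sgn_div_norm)
  have "((\<lambda>y. inverse (norm y) *\<^sub>R y) has_derivative
      (\<lambda>h. inverse (norm x) *\<^sub>R h + (- (inverse (norm x) * (h \<bullet> sgn x) * inverse (norm x))) *\<^sub>R x)) (at x)"
    by (intro has_derivative_scaleR Deriv.has_derivative_inverse[where f=norm, OF x(2)] has_derivative_norm[OF x(1)] has_derivative_ident)
  then have "((\<lambda>y. inverse (norm y) *\<^sub>R y) has_derivative (\<lambda>h. h - (x \<bullet> h) *\<^sub>R x)) (at x)"
    using assms x(3) by (simp add: inner_commute)
  then show ?thesis by (simp only: sgn)
qed

lemma has_derivative_comp_sgn:
  fixes X :: "real^3 \<Rightarrow> 'b::real_normed_vector"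
  assumes "(X has_derivative D) (at x)" "x \<in> S2"
  shows "((\<lambda>y. X (sgn y)) has_derivative (\<lambda>h. D (h - (x \<bullet> h) *\<^sub>R x))) (at x)"
proof -
  have "norm x = 1" "sgn x = x" using assms(2) by (auto simp: sgn_div_norm)
  then show ?thesis
    using has_derivative_compose[OF has_derivative_sgn_unit, of x X D] assms(1) by simp
qed

text \<open>By the chain rule through the projection only the tangential part of the ambient
  gradient survives; the scalar that multiplies \<open>x\<close> is the radial derivative of
  \<open>g\<close>.\<close>

lemma sph_grad_extension:
  assumes U: "open U" "S2 \<subseteq> U" and g: "g differentiable_on U" and fg: "\<And>x. x \<in> S2 \<Longrightarrow> f x = g x"
    and x: "x \<in> S2"
  shows "sph_grad f x = egrad g x - frechet_derivative g (at x) x *\<^sub>R x"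
proof -
  have D: "(g has_derivative frechet_derivative g (at x)) (at x)"
    using differentiable_on_openD[OF g U(1)] U(2) x by blast
  have "frechet_derivative (\<lambda>y. f (sgn y)) (at x) = frechet_derivative (\<lambda>y. g (sgn y)) (at x)"
  proof (rule frechet_derivative_cong_open)
    show "open (- {0 :: real^3})" by (rule open_Compl) simp
    show "x \<in> - {0}" using x by auto
    show "f (sgn y) = g (sgn y)" if "y \<in> - {0}" for y
      using that by (intro fg) (simp add: norm_sgn)
  qed
  then have "sph_grad f x $ i = frechet_derivative g (at x) (axis i 1 - (x \<bullet> axis i 1) *\<^sub>R x)" for i
    by (simp add: sph_grad_def frechet_derivativeI[OF has_derivative_comp_sgn[OF D x]])
  then show ?thesis
    by (simp add: vec_eq_iff egrad_nth linear_diff[OF has_derivative_linear[OF D]]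
        linear_cmul[OF has_derivative_linear[OF D]] inner_axis mult.commute)
qed

lemma bounded_bilinear_cross3: "bounded_bilinear cross3"
  using bilinear_cross by (simp add: bilinear_conv_bounded_bilinear)

lemma Ck_on_cross_egrad:
  assumes U: "open U" and g: "\<And>k. Ck_on k g U"
  shows "Ck_on k (\<lambda>y. cross3 y (egrad g y)) U"
proof (intro bounded_bilinear.Ck_on_prod[OF bounded_bilinear_cross3 U] Ck_on_id)
  have "Ck_on k (\<lambda>y. frechet_derivative g (at y) (axis j 1)) U" for j
    using g[of "Suc k"] by (simp add: axis_in_Basis_iff)
  then show "Ck_on k (egrad g) U"
    unfolding egrad_def
    by (intro Ck_on_sum[OF U] bounded_bilinear.Ck_on_prod[OF bounded_bilinear_scaleR U] Ck_on_const)
qed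

text \<open>The spherical form of the fact that \<open>y \<times> \<nabla>g\<close> has zero
  divergence. With the Hessian \<open>H\<close>, the trace of
  \<open>v \<mapsto> x \<times> H v\<close> vanishes because \<open>H\<close> is symmetric, and that
  of \<open>v \<mapsto> v \<times> \<nabla>g\<close> term by term. The correction from the
  projection is the inner product of \<open>x\<close> with \<open>x \<times> H x\<close> and
  \<open>x \<times> \<nabla>g\<close>, hence zero.\<close>

lemma sph_div_cross_egrad:
  assumes U: "open U" "S2 \<subseteq> U" and g: "Ck_on 2 g U" and x: "x \<in> S2"
  shows "sph_div (\<lambda>y. cross3 y (egrad g y)) x = 0"
proof -
  define h where "h j k = frechet_derivative (\<lambda>y. frechet_derivative g (at y) (axis j 1)) (at x) (axis k 1)" for j k :: 3
  define H where "H v = (\<Sum>j\<in>UNIV. frechet_derivative (\<lambda>y. frechet_derivative g (at y) (axis j 1)) (at x) v *\<^sub>R (axis j 1 :: real^3))" for v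
  have h_sym: "h j k = h k j" for j k
    unfolding h_def using U x g by (intro mixed_partials_commute) (auto simp: axis_in_Basis_iff)
  have D: "((\<lambda>y. frechet_derivative g (at y) (axis j 1)) has_derivative
      frechet_derivative (\<lambda>y. frechet_derivative g (at y) (axis j 1)) (at x)) (at x)" for j
    by (rule differentiable_on_openD[OF _ U(1)]) (use g U x in \<open>auto simp: numeral_2_eq_2 axis_in_Basis_iff\<close>)
  have H_nth: "H v $ j = v $ 1 * h j 1 + v $ 2 * h j 2 + v $ 3 * h j 3" for v j
    using linear_vec3_expand[OF has_derivative_linear[OF D], of j v]
    by (simp add: H_def h_def axis_def if_distrib cong: if_cong)
  have "(egrad g has_derivative H) (at x)"
    unfolding egrad_def H_def
    by (intro has_derivative_sum has_derivative_scaleR_left D)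
  then have "((\<lambda>y. cross3 y (egrad g y)) has_derivative (\<lambda>v. cross3 x (H v) + cross3 v (egrad g x))) (at x)"
    by (intro bounded_bilinear.FDERIV[OF bounded_bilinear_cross3] has_derivative_ident)
  note frechet_derivativeI[OF has_derivative_comp_sgn[OF this x]]
  then have "sph_div (\<lambda>y. cross3 y (egrad g y)) x = (\<Sum>i\<in>UNIV. (cross3 x (H (axis i 1 - x $ i *\<^sub>R x))
      + cross3 (axis i 1 - x $ i *\<^sub>R x) (egrad g x)) $ i)"
    by (simp add: sph_div_def inner_axis)
  also have "\<dots> = 0"
    by (simp add: sum_3 cross_components H_nth axis_def h_sym[of 2 1] h_sym[of 3 1] h_sym[of 3 2] algebra_simps)
  finally show ?thesis .
qed

text \<open>With \<open>W\<close> the weak gradient of a stream function, \<open>x \<times> W\<close> is weakly divergence free: test the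
  definition of \<open>W\<close> against the smooth divergence-free tangent field \<open>x \<times> \<nabla>g\<close>.\<close>

lemma integral_rot90_weak_grad:
  assumes W: "weak_grad u W" and U: "open U" "S2 \<subseteq> U" and g: "\<And>k. Ck_on k g U"
    and fg: "\<And>x. x \<in> S2 \<Longrightarrow> f x = g x"
  shows "(\<integral>x. rot90 x (W x) \<bullet> sph_grad f x \<partial>area) = 0"
proof -
  let ?X = "\<lambda>y. cross3 y (egrad g y)"
  have "smooth_tangent_field ?X"
    unfolding smooth_tangent_field_def smooth_on_def
    using U Ck_on_cross_egrad[OF U(1) g] by (auto simp: dot_cross_self)
  then have "(\<integral>x. u x * sph_div ?X x \<partial>area) = - (\<integral>x. W x \<bullet> ?X x \<partial>area)"
    using W by (simp add: weak_grad_def)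
  moreover have "(\<integral>x. u x * sph_div ?X x \<partial>area) = (\<integral>x. 0 \<partial>area)"
    by (intro Bochner_Integration.integral_cong) (auto simp: sph_div_cross_egrad[OF U g])
  moreover have "(\<integral>x. rot90 x (W x) \<bullet> sph_grad f x \<partial>area) = (\<integral>x. - (W x \<bullet> ?X x) \<partial>area)"
  proof (intro Bochner_Integration.integral_cong refl)
    fix x assume "x \<in> space area"
    then have "sph_grad f x = egrad g x - frechet_derivative g (at x) x *\<^sub>R x"
      using g[of 1] by (intro sph_grad_extension[OF U _ fg]) auto
    \<comment> \<open>The radial part of the ambient gradient drops out because
      \<open>x \<times> W\<close> is orthogonal to \<open>x\<close>; the sign then comes from the
      scalar triple product.\<close>
    then have "rot90 x (W x) \<bullet> sph_grad f x = cross3 x (W x) \<bullet> egrad g x"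
      by (simp add: rot90_def inner_diff_right dot_cross_self)
    also have "\<dots> = - (W x \<bullet> ?X x)"
      by (simp add: inner_vec_def sum_3 cross_components algebra_simps)
    finally show "rot90 x (W x) \<bullet> sph_grad f x = - (W x \<bullet> ?X x)" .
  qed
  ultimately show ?thesis by simp
qed

section \<open>Conservation of the distribution of vorticity\<close>

text \<open>By compactness of \<open>S2 \<times> {0..T}\<close>. The modulus in time is common to
  all points of the sphere, which takes the place of a dominating function below.\<close>

lemma uniformly_continuous_in_time:
  fixes H :: "(real^3) \<times> real \<Rightarrow> real"
  assumes "continuous_on (S2 \<times> {0..}) H" "0 < e"
  obtains d where "0 < d"
    "\<forall>x\<in>S2. \<forall>s\<in>{0..T}. \<forall>t\<in>{0..T}. \<bar>s - t\<bar> < d \<longrightarrow> \<bar>H (x, s) - H (x, t)\<bar> < e"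
proof -
  have "uniformly_continuous_on (S2 \<times> {0..T}) H"
    by (intro compact_uniformly_continuous compact_Times continuous_on_subset[OF assms(1)]) auto
  then obtain d where "0 < d"
    and d: "\<And>z w. z \<in> S2 \<times> {0..T} \<Longrightarrow> w \<in> S2 \<times> {0..T} \<Longrightarrow> dist w z < d \<Longrightarrow> dist (H w) (H z) < e"
    using assms(2) unfolding uniformly_continuous_on_def by metis
  show thesis
  proof (rule that[OF \<open>0 < d\<close>], intro ballI impI)
    fix x :: "real^3" and s t :: real
    assume "x \<in> S2" "s \<in> {0..T}" "t \<in> {0..T}" "\<bar>s - t\<bar> < d"
    then show "\<bar>H (x, s) - H (x, t)\<bar> < e"
      using d[of "(x, t)" "(x, s)"] by (simp add: dist_Pair_Pair dist_real_def)
  qed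
qed

lemma continuous_on_slice:
  "continuous_on (A \<times> B) H \<Longrightarrow> t \<in> B \<Longrightarrow> continuous_on A (\<lambda>x. H (x, t))"
  by (rule continuous_on_compose2[of "A \<times> B" H]) (auto intro!: continuous_intros)

text \<open>Pointwise, the mean value theorem replaces the increment of \<open>H\<close> by its time
  derivative at an intermediate time, and this is uniformly close to the one at \<open>t\<close>;
  the error is then integrated over a space of finite measure.\<close>

lemma has_derivative_integral_area:
  assumes U: "open U" "S2 \<times> {0..} \<subseteq> U" and H: "Ck_on 1 H U" and t: "0 < t"
  shows "((\<lambda>t. \<integral>x. H (x, t) \<partial>area) has_real_derivative
     (\<integral>x. frechet_derivative H (at (x, t)) (0, 1) \<partial>area)) (at t)"
proof -
  let ?H' = "\<lambda>z. frechet_derivative H (at z) (0, 1 :: real)"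
  have "(0, 1) \<in> (Basis :: ((real^3) \<times> real) set)" by (simp add: Basis_prod_def)
  then have H1: "H differentiable_on U" and H'0: "continuous_on U ?H'" using H by auto
  have H': "continuous_on (S2 \<times> {0..}) ?H'" by (rule continuous_on_subset[OF H'0 U(2)])
  have H0: "continuous_on (S2 \<times> {0..}) H"
    by (rule continuous_on_subset[OF differentiable_imp_continuous_on[OF H1] U(2)])
  have D: "((\<lambda>s. H (x, s)) has_real_derivative ?H' (x, s)) (at s)" if "x \<in> S2" "0 \<le> s" for x s
  proof -
    have d: "(H has_derivative frechet_derivative H (at (x, s))) (at (x, s))"
      by (rule differentiable_on_openD[OF H1 U(1)]) (use U(2) that in auto)
    have "((\<lambda>s. H (x, s)) has_derivative (\<lambda>r. frechet_derivative H (at (x, s)) (0, r))) (at s)"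
      by (rule has_derivative_compose[where f="\<lambda>s. (x, s)" and g=H, OF _ d]) (auto intro!: derivative_eq_intros)
    moreover have "(\<lambda>r. frechet_derivative H (at (x, s)) (0, r)) = (\<lambda>r. ?H' (x, s) * r)"
    proof
      show "frechet_derivative H (at (x, s)) (0, r) = ?H' (x, s) * r" for r
        using linear_cmul[OF has_derivative_linear[OF d], of r "(0, 1)"] by simp
    qed
    ultimately show ?thesis unfolding has_field_derivative_def by (simp only:)
  qed
  have int: "integrable area (\<lambda>x. H (x, s))" "integrable area (\<lambda>x. ?H' (x, s))" if "0 \<le> s" for s
    using that by (auto intro!: integrable_area_continuous continuous_on_slice[OF H0] continuous_on_slice[OF H'])
  let ?I = "\<lambda>t. \<integral>x. H (x, t) \<partial>area" and ?J = "\<integral>x. ?H' (x, t) \<partial>area"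
  let ?m = "measure area (space area)"
  have "\<exists>d>0. \<forall>s\<in>UNIV. norm (s - t) < d \<longrightarrow> norm (?I s - ?I t - ?J * (s - t)) \<le> e * norm (s - t)" if "0 < e" for e
  proof -
    \<comment> \<open>Integrating this bound over mass \<open>?m\<close> leaves at most
      \<open>e\<close>; the summand 1 avoids a zero denominator.\<close>
    have e': "0 < e / (?m + 1)" using that by (simp add: add_nonneg_pos)
    obtain d where d: "0 < d" "\<forall>x\<in>S2. \<forall>s\<in>{0..2 * t}. \<forall>s'\<in>{0..2 * t}. \<bar>s - s'\<bar> < d
        \<longrightarrow> \<bar>?H' (x, s) - ?H' (x, s')\<bar> < e / (?m + 1)"
      by (rule uniformly_continuous_in_time[OF H' e', of "2 * t"])
    \<comment> \<open>The bound \<open>t\<close> on the increment keeps \<open>s\<close> in the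
      interval from 0 to \<open>2 * t\<close>, where \<open>H\<close> is controlled on both sides of
      \<open>t\<close>.\<close>
    have "norm (?I s - ?I t - ?J * (s - t)) \<le> e * norm (s - t)" if s: "norm (s - t) < min d t" for s
    proof -
      have s0: "0 \<le> s" "s \<le> 2 * t" using s t by auto
      have pt: "\<bar>H (x, s) - H (x, t) - ?H' (x, t) * (s - t)\<bar> \<le> e / (?m + 1) * \<bar>s - t\<bar>" if x: "x \<in> S2" for x
      proof (cases "s = t")
        case False
        have "\<exists>r. \<bar>r - t\<bar> \<le> \<bar>s - t\<bar> \<and> 0 \<le> r \<and> r \<le> 2 * t \<and> H (x, s) - H (x, t) = (s - t) * ?H' (x, r)"
        proof (cases "s < t")
          case True
          obtain r where "s < r" "r < t" "H (x, t) - H (x, s) = (t - s) * ?H' (x, r)"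
            using MVT2[OF True, of "\<lambda>s. H (x, s)" "\<lambda>s. ?H' (x, s)"] D[OF x] s0 by auto
          then show ?thesis using s0 t by (intro exI[of _ r]) (auto simp: algebra_simps)
        next
          case False
          then have "t < s" using \<open>s \<noteq> t\<close> by simp
          then obtain r where "t < r" "r < s" "H (x, s) - H (x, t) = (s - t) * ?H' (x, r)"
            using MVT2[of t s "\<lambda>s. H (x, s)" "\<lambda>s. ?H' (x, s)"] D[OF x] t by auto
          then show ?thesis using s0 t by (intro exI[of _ r]) auto
        qed
        then obtain r where r: "\<bar>r - t\<bar> \<le> \<bar>s - t\<bar>" "0 \<le> r" "r \<le> 2 * t"
          "H (x, s) - H (x, t) = (s - t) * ?H' (x, r)" by blast
        have "\<bar>?H' (x, r) - ?H' (x, t)\<bar> \<le> e / (?m + 1)"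
          using d(2)[rule_format, OF x, of r t] r s t by auto
        moreover have "H (x, s) - H (x, t) - ?H' (x, t) * (s - t) = (?H' (x, r) - ?H' (x, t)) * (s - t)"
          by (simp add: r(4) algebra_simps)
        ultimately show ?thesis by (simp only: abs_mult) (intro mult_right_mono abs_ge_zero)
      qed simp
      have i: "integrable area (\<lambda>x. H (x, s) - H (x, t) - ?H' (x, t) * (s - t))"
        using int[of s] int[of t] s0 t by auto
      have "?I s - ?I t - ?J * (s - t) = (\<integral>x. H (x, s) - H (x, t) - ?H' (x, t) * (s - t) \<partial>area)"
        using int[of s] int[of t] s0 t by simp
      also have "\<bar>\<dots>\<bar> \<le> (\<integral>x. \<bar>H (x, s) - H (x, t) - ?H' (x, t) * (s - t)\<bar> \<partial>area)"
        by (rule integral_abs_bound)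
      also have "\<dots> \<le> (\<integral>x. e / (?m + 1) * \<bar>s - t\<bar> \<partial>area)"
        using i pt by (intro integral_mono) auto
      also have "\<dots> = (e / (?m + 1) * ?m) * \<bar>s - t\<bar>" by simp
      also have "\<dots> \<le> e * \<bar>s - t\<bar>"
      proof (rule mult_right_mono)
        have "e / (?m + 1) * ?m \<le> e / (?m + 1) * (?m + 1)" using e' by (intro mult_left_mono) auto
        also have "\<dots> = e" using measure_nonneg[of area "space area"] by (intro nonzero_eq_divide_eq[THEN iffD1, OF _ refl]) linarith
        finally show "e / (?m + 1) * ?m \<le> e" .
      qed simp
      finally show ?thesis by (simp only: real_norm_def)
    qed
    then show ?thesis using d(1) t by (intro exI[of _ "min d t"]) auto
  qed
  then show ?thesis
    unfolding has_field_derivative_def has_derivative_within_alt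
    by (intro conjI bounded_linear_mult_right) blast
qed

text \<open>The equation is given at positive times only; continuity up to time 0 links the moments
  there to the initial ones.\<close>

lemma continuous_on_integral_area:
  fixes H :: "(real^3) \<times> real \<Rightarrow> real"
  assumes H: "continuous_on (S2 \<times> {0..}) H"
  shows "continuous_on {0..T} (\<lambda>t. \<integral>x. H (x, t) \<partial>area)"
proof (rule continuous_onI)
  let ?m = "measure area (space area)"
  fix t e :: real assume e: "0 < e" and t: "t \<in> {0..T}"
  have e': "0 < e / (?m + 1)" using e by (simp add: add_nonneg_pos)
  obtain d where d: "0 < d" "\<forall>x\<in>S2. \<forall>s\<in>{0..T}. \<forall>s'\<in>{0..T}. \<bar>s - s'\<bar> < d
      \<longrightarrow> \<bar>H (x, s) - H (x, s')\<bar> < e / (?m + 1)"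
    by (rule uniformly_continuous_in_time[OF H e', of T])
  have "dist (\<integral>x. H (x, s) \<partial>area) (\<integral>x. H (x, t) \<partial>area) \<le> e" if s: "s \<in> {0..T}" "dist s t < d" for s
  proof -
    have int: "integrable area (\<lambda>x. H (x, s))" "integrable area (\<lambda>x. H (x, t))"
      using s t by (auto intro!: integrable_area_continuous continuous_on_slice[OF H])
    then have "(\<integral>x. H (x, s) \<partial>area) - (\<integral>x. H (x, t) \<partial>area) = (\<integral>x. H (x, s) - H (x, t) \<partial>area)" by simp
    also have "\<bar>\<dots>\<bar> \<le> (\<integral>x. \<bar>H (x, s) - H (x, t)\<bar> \<partial>area)"
      by (rule integral_abs_bound)
    also have "\<dots> \<le> (\<integral>x. e / (?m + 1) \<partial>area)"
      using int d(2)[rule_format, OF _ s(1) t] s by (intro integral_mono) (auto simp: dist_real_def less_imp_le)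
    also have "\<dots> = e * (?m / (?m + 1))" by simp
    also have "\<dots> \<le> e * 1"
      using e by (intro mult_left_mono) (auto simp: divide_le_eq_1 add_nonneg_pos)
    also have "\<dots> = e" by simp
    finally show ?thesis by (simp only: dist_real_def)
  qed
  then show "\<exists>d>0. \<forall>s\<in>{0..T}. dist s t < d \<longrightarrow> dist (\<integral>x. H (x, s) \<partial>area) (\<integral>x. H (x, t) \<partial>area) \<le> e"
    using d(1) by blast
qed

section \<open>Conservation of moments\<close>

text \<open>Multiplying the equation for \<open>\<zeta>\<close> by
  \<open>n * \<zeta> ^ (n - 1)\<close> thereby gives the same equation for the power. For
  \<open>n = 0\<close> the truncated exponent does no harm, since the coefficient vanishes.\<close>

lemma sph_grad_power:
  assumes U: "open U" "S2 \<subseteq> U" and g: "g differentiable_on U" and fg: "\<And>x. x \<in> S2 \<Longrightarrow> f x = g x"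
    and x: "x \<in> S2"
  shows "sph_grad (\<lambda>y. f y ^ n) x = (of_nat n * f x ^ (n - 1)) *\<^sub>R sph_grad f x"
proof -
  have D: "((\<lambda>y. g y ^ n) has_derivative (\<lambda>v. of_nat n * frechet_derivative g (at y) v * g y ^ (n - 1))) (at y)"
    if "y \<in> U" for y
    by (rule has_derivative_power[OF differentiable_on_openD[OF g U(1) that]])
  then have gn: "(\<lambda>y. g y ^ n) differentiable_on U"
    using U(1) differentiable_on_eq_differentiable_at differentiable_def by blast
  have "frechet_derivative (\<lambda>y. g y ^ n) (at x) = (\<lambda>v. of_nat n * frechet_derivative g (at x) v * g x ^ (n - 1))"
    using D U(2) x by (intro frechet_derivativeI) auto
  then have "egrad (\<lambda>y. g y ^ n) x = (of_nat n * g x ^ (n - 1)) *\<^sub>R egrad g x"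
    and "frechet_derivative (\<lambda>y. g y ^ n) (at x) x = of_nat n * g x ^ (n - 1) * frechet_derivative g (at x) x"
    by (simp_all add: vec_eq_iff egrad_nth)
  moreover have "sph_grad (\<lambda>y. f y ^ n) x
      = egrad (\<lambda>y. g y ^ n) x - frechet_derivative (\<lambda>y. g y ^ n) (at x) x *\<^sub>R x"
    by (rule sph_grad_extension[OF U gn _ x]) (simp only: fg)
  ultimately show ?thesis
    by (simp only: sph_grad_extension[OF U g fg x] fg[OF x] scaleR_diff_right scaleR_scaleR)
qed

lemma smooth_solutionE:
  assumes "smooth_solution \<omega> \<zeta>"
  obtains U G where "open U" "S2 \<times> {0..} \<subseteq> U" "\<And>k. Ck_on k G U"
    "\<And>x t. x \<in> S2 \<Longrightarrow> 0 \<le> t \<Longrightarrow> G (x, t) = \<zeta> t x"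
  using assms unfolding smooth_solution_def smooth_on_def by fastforce

lemma smooth_solution_continuous_on:
  assumes "smooth_solution \<omega> \<zeta>"
  shows "continuous_on (S2 \<times> {0..}) (\<lambda>(x, t). \<zeta> t x)"
proof -
  obtain U G where UG: "open U" "S2 \<times> {0..} \<subseteq> U" "\<And>k. Ck_on k G U"
    and G: "\<And>x t. x \<in> S2 \<Longrightarrow> 0 \<le> t \<Longrightarrow> G (x, t) = \<zeta> t x"
    by (rule smooth_solutionE[OF assms]) blast
  have "continuous_on (S2 \<times> {0..}) G"
    using UG(3)[of 0] continuous_on_subset[OF _ UG(2)] by simp
  then show ?thesis
    by (rule continuous_on_eq) (use G in auto)
qed

text \<open>\<open>\<integral>\<zeta>\<^sup>n\<close> is conserved because its time derivative is the integral of \<open>- (x \<times> W) \<cdot> \<nabla>(\<zeta>\<^sup>n)\<close>. This avoids the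
  flow map of the velocity, whose regularity in time is not part of the hypotheses.\<close>

lemma smooth_solution_moments:
  assumes sol: "smooth_solution \<omega> \<zeta>" and t: "0 < t"
  shows "(\<integral>x. \<zeta> t x ^ n \<partial>area) = (\<integral>x. \<zeta> 0 x ^ n \<partial>area)"
proof -
  obtain U G where U: "open U" "S2 \<times> {0..} \<subseteq> U" and Ck: "\<And>k. Ck_on k G U"
    and G: "\<And>x t. x \<in> S2 \<Longrightarrow> 0 \<le> t \<Longrightarrow> G (x, t) = \<zeta> t x"
    by (rule smooth_solutionE[OF sol]) blast
  let ?H = "\<lambda>z. G z ^ n"
  have H: "Ck_on k ?H U" for k by (rule Ck_on_power[OF U(1) Ck])
  have H0: "continuous_on (S2 \<times> {0..}) ?H"
    using H[of 0] continuous_on_subset[OF _ U(2)] by simp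
  have zero: "(\<integral>x. frechet_derivative ?H (at (x, s)) (0, 1) \<partial>area) = 0" if s: "0 < s" for s
  proof -
    obtain W where W: "weak_grad (\<lambda>x. \<omega> * x $ 3 - inv_laplacian (\<zeta> s) x) W"
      and eq: "\<And>x. x \<in> S2 \<Longrightarrow> deriv (\<lambda>s. \<zeta> s x) s + rot90 x (W x) \<bullet> sph_grad (\<zeta> s) x = 0"
      using sol s unfolding smooth_solution_def by blast
    let ?V = "{x. (x, s) \<in> U}"
    have V: "open ?V"
      using open_vimage[OF U(1), of "\<lambda>x. (x, s)"] by (simp add: vimage_def continuous_on_Pair)
    have SV: "S2 \<subseteq> ?V" using U(2) s by auto
    have Gs: "(\<lambda>x. G (x, s)) differentiable_on ?V"
      using Ck_on_slice[OF U(1) Ck[of 1], of s] by simp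
    have "(\<integral>x. rot90 x (W x) \<bullet> sph_grad (\<lambda>x. \<zeta> s x ^ n) x \<partial>area) = 0"
      using G s by (intro integral_rot90_weak_grad[OF W V SV Ck_on_slice[OF U(1) H]]) auto
    moreover have "frechet_derivative ?H (at (x, s)) (0, 1) = - (rot90 x (W x) \<bullet> sph_grad (\<lambda>x. \<zeta> s x ^ n) x)"
      if x: "x \<in> S2" for x
    proof -
      have xs: "(x, s) \<in> U" using x s U(2) by auto
      have d: "(G has_derivative frechet_derivative G (at (x, s))) (at (x, s))"
        using Ck[of 1] xs by (intro differentiable_on_openD[OF _ U(1)]) auto
      have "((\<lambda>r. G (x, r)) has_derivative (\<lambda>r. frechet_derivative G (at (x, s)) (0, r))) (at s)"
        by (rule has_derivative_compose[where f="\<lambda>r. (x, r)" and g=G, OF _ d]) (auto intro!: derivative_eq_intros)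
      moreover have "(\<lambda>r. frechet_derivative G (at (x, s)) (0, r)) = (\<lambda>r. frechet_derivative G (at (x, s)) (0, 1) * r)"
      proof
        show "frechet_derivative G (at (x, s)) (0, r) = frechet_derivative G (at (x, s)) (0, 1) * r" for r
          using linear_cmul[OF has_derivative_linear[OF d], of r "(0, 1)"] by simp
      qed
      ultimately have "((\<lambda>r. G (x, r)) has_real_derivative frechet_derivative G (at (x, s)) (0, 1)) (at s)"
        unfolding has_field_derivative_def by (simp only:)
      \<comment> \<open>\<open>\<zeta>\<close> agrees with its extension \<open>G\<close> only at
        nonnegative times, which is a neighbourhood of \<open>s\<close> because \<open>s\<close> is
        positive.\<close>
      then have "((\<lambda>r. \<zeta> r x) has_real_derivative frechet_derivative G (at (x, s)) (0, 1)) (at s)"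
        by (rule has_field_derivative_transform_within_open[where S="{0<..}"]) (use G x s in auto)
      then have "deriv (\<lambda>r. \<zeta> r x) s = frechet_derivative G (at (x, s)) (0, 1)"
        by (rule DERIV_imp_deriv)
      moreover have "frechet_derivative ?H (at (x, s)) (0, 1)
          = of_nat n * frechet_derivative G (at (x, s)) (0, 1) * G (x, s) ^ (n - 1)"
        by (simp add: frechet_derivativeI[OF has_derivative_power[OF d]])
      moreover have "sph_grad (\<lambda>x. \<zeta> s x ^ n) x = (of_nat n * \<zeta> s x ^ (n - 1)) *\<^sub>R sph_grad (\<zeta> s) x"
        using G s by (intro sph_grad_power[OF V SV Gs _ x]) auto
      ultimately show ?thesis
        using eq[OF x] G[OF x, of s] s by (simp add: add_eq_0_iff2)
    qed
    ultimately have "(\<integral>x. - frechet_derivative ?H (at (x, s)) (0, 1) \<partial>area) = 0"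
      by (subst Bochner_Integration.integral_cong[OF refl]) auto
    then show ?thesis by simp
  qed
  have "(\<integral>x. ?H (x, t) \<partial>area) = (\<integral>x. ?H (x, 0) \<partial>area)"
  proof (rule DERIV_isconst_end[OF t])
    show "continuous_on {0..t} (\<lambda>t. \<integral>x. ?H (x, t) \<partial>area)"
      by (rule continuous_on_integral_area[OF H0])
    show "((\<lambda>t. \<integral>x. ?H (x, t) \<partial>area) has_real_derivative 0) (at s)" if "0 < s" "s < t" for s
      using has_derivative_integral_area[OF U H that(1)] zero[OF that(1)] by simp
  qed
  moreover have "(\<integral>x. ?H (x, s) \<partial>area) = (\<integral>x. \<zeta> s x ^ n \<partial>area)" if "0 \<le> s" for s
    by (rule Bochner_Integration.integral_cong) (use G that in auto)
  ultimately show ?thesis using t by simp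
qed

section \<open>Bounded laws are determined by their moments\<close>

text \<open>Equal moments give equal integrals of polynomials; the Weierstrass theorem on the
  interval from \<open>-B\<close> to \<open>B\<close> extends this to continuous functions, and
  ramps converging to indicators of half-lines extend it to the laws.\<close>

lemma (in finite_measure) distr_eq_if_moments_eq:
  fixes g h :: "'a \<Rightarrow> real"
  assumes g[measurable]: "g \<in> borel_measurable M" and h[measurable]: "h \<in> borel_measurable M"
    and bound: "\<And>x. x \<in> space M \<Longrightarrow> \<bar>g x\<bar> \<le> B" "\<And>x. x \<in> space M \<Longrightarrow> \<bar>h x\<bar> \<le> B"
    and moments: "\<And>n. (\<integral>x. g x ^ n \<partial>M) = (\<integral>x. h x ^ n \<partial>M)"
  shows "distr M borel g = distr M borel h"
proof -
  have pow: "integrable M (\<lambda>x. u x ^ n)"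
    if [measurable]: "u \<in> borel_measurable M" and u: "\<And>x. x \<in> space M \<Longrightarrow> \<bar>u x\<bar> \<le> B" for u :: "'a \<Rightarrow> real" and n
    using u by (intro integrable_const_bound[of _ "B ^ n"] AE_I2) (auto simp: power_abs intro!: power_mono)
  have cont: "(\<integral>x. F (g x) \<partial>M) = (\<integral>x. F (h x) \<partial>M)" if F: "continuous_on UNIV F" for F :: "real \<Rightarrow> real"
  proof -
    have [measurable]: "F \<in> borel_measurable borel" using F by (rule borel_measurable_continuous_onI)
    have "\<bar>(\<integral>x. F (g x) \<partial>M) - (\<integral>x. F (h x) \<partial>M)\<bar> \<le> e" if e: "0 < e" for e
    proof -
      let ?m = "measure M (space M)"
      \<comment> \<open>The approximation is paid twice, once for \<open>g\<close> and once for
        \<open>h\<close>, each time with mass \<open>?m\<close>.\<close>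
      have e': "0 < e / (2 * ?m + 1)" using e by (simp add: add_nonneg_pos)
      obtain q where q: "real_polynomial_function q" "\<And>y. y \<in> {-B..B} \<Longrightarrow> \<bar>F y - q y\<bar> < e / (2 * ?m + 1)"
        by (rule Stone_Weierstrass_real_polynomial_function[OF _ continuous_on_subset[OF F] e', of "{-B..B}"]) auto
      then obtain a N where a: "q = (\<lambda>y. \<Sum>i\<le>N. a i * y ^ i)"
        unfolding real_polynomial_function_iff_sum by blast
      have [measurable]: "q \<in> borel_measurable borel" unfolding a by measurable
      have near: "integrable M (\<lambda>x. q (u x))" "\<bar>(\<integral>x. F (u x) \<partial>M) - (\<integral>x. q (u x) \<partial>M)\<bar> \<le> e / (2 * ?m + 1) * ?m"
        if [measurable]: "u \<in> borel_measurable M" and u: "\<And>x. x \<in> space M \<Longrightarrow> \<bar>u x\<bar> \<le> B" for u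
      proof -
        have close: "\<bar>F (u x) - q (u x)\<bar> \<le> e / (2 * ?m + 1)" if "x \<in> space M" for x
          using q(2)[of "u x"] u[OF that] by (auto simp: abs_le_iff)
        show qi: "integrable M (\<lambda>x. q (u x))"
          unfolding a using pow[OF that] by auto
        have di: "integrable M (\<lambda>x. F (u x) - q (u x))"
          using close by (intro integrable_const_bound[of _ "e / (2 * ?m + 1)"] AE_I2) auto
        have Fi: "integrable M (\<lambda>x. F (u x))"
          using Bochner_Integration.integrable_add[OF di qi] by simp
        have "(\<integral>x. F (u x) \<partial>M) - (\<integral>x. q (u x) \<partial>M) = (\<integral>x. F (u x) - q (u x) \<partial>M)"
          using Fi qi by simp
        also have "\<bar>\<dots>\<bar> \<le> (\<integral>x. \<bar>F (u x) - q (u x)\<bar> \<partial>M)"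
          by (rule integral_abs_bound)
        also have "\<dots> \<le> (\<integral>x. e / (2 * ?m + 1) \<partial>M)"
          using di close by (intro integral_mono) auto
        finally show "\<bar>(\<integral>x. F (u x) \<partial>M) - (\<integral>x. q (u x) \<partial>M)\<bar> \<le> e / (2 * ?m + 1) * ?m"
          by (simp add: mult.commute)
      qed
      have "(\<integral>x. q (g x) \<partial>M) = (\<integral>x. q (h x) \<partial>M)"
        unfolding a using pow[OF g bound(1)] pow[OF h bound(2)] moments by simp
      then have "\<bar>(\<integral>x. F (g x) \<partial>M) - (\<integral>x. F (h x) \<partial>M)\<bar> \<le> 2 * (e / (2 * ?m + 1) * ?m)"
        using near(2)[OF g bound(1)] near(2)[OF h bound(2)] by simp
      also have "\<dots> = e / (2 * ?m + 1) * (2 * ?m)" by simp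
      also have "\<dots> \<le> e / (2 * ?m + 1) * (2 * ?m + 1)"
        using e' by (intro mult_left_mono) auto
      also have "\<dots> = e"
        using measure_nonneg[of M "space M"] by (intro nonzero_eq_divide_eq[THEN iffD1, OF _ refl]) linarith
      finally show ?thesis .
    qed
    then have "\<bar>(\<integral>x. F (g x) \<partial>M) - (\<integral>x. F (h x) \<partial>M)\<bar> \<le> 0"
      by (rule field_le_epsilon) (simp only: add_0_left)
    then show ?thesis by simp
  qed
  \<comment> \<open>The ramps rise from 0 at \<open>s\<close> with slope \<open>n\<close> and are
    cut off at 1; they tend pointwise to the indicator of the open half-line, value 0 at
    \<open>s\<close> included, and are dominated by 1.\<close>
  have lim: "(\<lambda>n. \<integral>x. min 1 (max 0 (real n * (u x - s))) \<partial>M) \<longlonglongrightarrow> measure (distr M borel u) {s<..}"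
    if [measurable]: "u \<in> borel_measurable M" for u s
  proof -
    have "(\<lambda>n. min 1 (max 0 (real n * (y - s)))) \<longlonglongrightarrow> indicator {s<..} y" for y
    proof (cases "s < y")
      case True
      obtain N where N: "1 / (y - s) \<le> real N" using real_arch_simple by blast
      have "min 1 (max 0 (real n * (y - s))) = 1" if "N \<le> n" for n
      proof -
        have "1 / (y - s) \<le> real n" using N that by linarith
        then have "1 \<le> real n * (y - s)" using True by (simp add: field_simps)
        then show ?thesis by simp
      qed
      then have "\<forall>\<^sub>F n in sequentially. min 1 (max 0 (real n * (y - s))) = 1"
        by (auto simp: eventually_sequentially)
      then show ?thesis using True by (simp add: tendsto_eventually)
    next
      case False
      then have "real n * (y - s) \<le> 0" for n
        by (simp add: mult_nonneg_nonpos)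
      then have "min 1 (max 0 (real n * (y - s))) = 0" for n
        by (simp add: max_absorb1)
      then show ?thesis using False by simp
    qed
    then have "(\<lambda>n. \<integral>x. min 1 (max 0 (real n * (u x - s))) \<partial>M) \<longlonglongrightarrow> (\<integral>x. indicator {s<..} (u x) \<partial>M)"
      by (intro integral_dominated_convergence[where w="\<lambda>_. 1"]) (auto intro!: AE_I2)
    also have "(\<integral>x. indicator {s<..} (u x) \<partial>M) = (\<integral>x. indicator (u -` {s<..} \<inter> space M) x \<partial>M)"
      by (intro Bochner_Integration.integral_cong) (auto simp: indicator_def)
    also have "\<dots> = measure (distr M borel u) {s<..}"
      by (simp add: measure_distr)
    finally show ?thesis .
  qed
  interpret g: finite_measure "distr M borel g" by (rule finite_measure_distr) simp
  interpret h: finite_measure "distr M borel h" by (rule finite_measure_distr) simp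
  have "measure (distr M borel g) {s<..} = measure (distr M borel h) {s<..}" for s
  proof (rule LIMSEQ_unique[OF lim[OF g]])
    have "(\<integral>x. min 1 (max 0 (real n * (g x - s))) \<partial>M) = (\<integral>x. min 1 (max 0 (real n * (h x - s))) \<partial>M)" for n
      by (rule cont[of "\<lambda>y. min 1 (max 0 (real n * (y - s)))"]) (intro continuous_intros)
    then show "(\<lambda>n. \<integral>x. min 1 (max 0 (real n * (g x - s))) \<partial>M) \<longlonglongrightarrow> measure (distr M borel h) {s<..}"
      using lim[OF h, of s] by simp
  qed
  then show ?thesis
    by (intro measure_eqI_lessThan)
      (auto simp: g.emeasure_eq_measure h.emeasure_eq_measure)
qed

lemma smooth_solution_continuous_on_S2:
  "smooth_solution \<omega> \<zeta> \<Longrightarrow> 0 \<le> t \<Longrightarrow> continuous_on S2 (\<zeta> t)"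
  using continuous_on_slice[OF smooth_solution_continuous_on, of \<omega> \<zeta> t] by simp

text \<open>Compactness of the sphere supplies one bound for the values at both times, as the moment
  argument requires.\<close>

lemma smooth_solution_distr_eq:
  assumes sol: "smooth_solution \<omega> \<zeta>" and t: "0 < t"
  shows "distr area borel (\<zeta> t) = distr area borel (\<zeta> 0)"
proof -
  have cont: "continuous_on S2 (\<zeta> t)" "continuous_on S2 (\<zeta> 0)"
    using smooth_solution_continuous_on_S2[OF sol] t by auto
  have "bounded (\<zeta> t ` S2 \<union> \<zeta> 0 ` S2)"
    using cont by (intro compact_imp_bounded compact_Un compact_continuous_image) auto
  then obtain B where "\<forall>y \<in> \<zeta> t ` S2 \<union> \<zeta> 0 ` S2. norm y \<le> B" unfolding bounded_iff by blast
  then show ?thesis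
    by (intro area.distr_eq_if_moments_eq[of _ _ B] borel_measurable_area cont smooth_solution_moments[OF sol t]) auto
qed

lemma smooth_solution_Lp0:
  assumes sol: "smooth_solution \<omega> \<zeta>" and t: "0 \<le> t" and p: "0 < p"
  shows "\<zeta> t \<in> Lp0 p"
proof -
  have cont: "continuous_on S2 (\<zeta> t)" by (rule smooth_solution_continuous_on_S2[OF sol t])
  then have "continuous_on S2 (\<lambda>x. \<bar>\<zeta> t x\<bar> powr p)"
    using p by (intro continuous_on_powr' continuous_intros) auto
  then show ?thesis
    using cont sol t unfolding Lp0_def Lp_def smooth_solution_def
    by (auto intro: borel_measurable_area integrable_area_continuous)
qed

section \<open>Stability\<close>

lemma Lp_norm_nonneg: "0 \<le> Lp_norm p f"
  by (simp add: Lp_norm_def)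

lemma Lp0_imp_Lp: "f \<in> Lp0 p \<Longrightarrow> f \<in> Lp p"
  by (simp add: Lp0_def)

lemma Lp_norm_minus_commute: "Lp_norm p (\<lambda>x. f x - g x) = Lp_norm p (\<lambda>x. g x - f x)"
  by (simp add: Lp_norm_def abs_minus_commute)

lemma
  assumes p: "1 \<le> p" and f: "f \<in> Lp p" and g: "g \<in> Lp p"
  shows Lp_diff: "(\<lambda>x. f x - g x) \<in> Lp p"
    and Lp_norm_diff_le: "Lp_norm p (\<lambda>x. f x - g x) \<le> Lp_norm p f + Lp_norm p g"
proof -
  have m: "f \<in> borel_measurable area" "(\<lambda>x. - g x) \<in> borel_measurable area"
    "integrable area (\<lambda>x. \<bar>f x\<bar> powr p)" "integrable area (\<lambda>x. \<bar>- g x\<bar> powr p)"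
    using f g by (auto simp: Lp_def)
  show "(\<lambda>x. f x - g x) \<in> Lp p" "Lp_norm p (\<lambda>x. f x - g x) \<le> Lp_norm p f + Lp_norm p g"
    using Minkowski_inequality[OF p m(1,3,2,4)] m by (auto simp: Lp_def Lp_norm_def)
qed

lemma Lp_norm_triangle:
  assumes "1 \<le> p" "f \<in> Lp p" "g \<in> Lp p" "h \<in> Lp p"
  shows "Lp_norm p (\<lambda>x. f x - h x) \<le> Lp_norm p (\<lambda>x. f x - g x) + Lp_norm p (\<lambda>x. g x - h x)"
  using Lp_norm_diff_le[OF assms(1) Lp_diff[OF assms(1,2,3)] Lp_diff[OF assms(1,4,3)]]
  by (simp add: Lp_norm_minus_commute[of p h g])

lemma Lp_norm_le_sum:
  assumes "1 \<le> p" "f \<in> Lp p" "g \<in> Lp p"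
  shows "Lp_norm p f \<le> Lp_norm p (\<lambda>x. f x - g x) + Lp_norm p g"
proof -
  have "(\<lambda>x. 0) \<in> Lp p" by (simp add: Lp_def)
  from Lp_norm_triangle[OF assms this] show ?thesis by simp
qed

lemma Lp_norm_le_sup:
  assumes p: "1 \<le> p" and f: "f \<in> Lp p" and le: "\<And>x. x \<in> S2 \<Longrightarrow> \<bar>f x\<bar> \<le> e" and e: "0 \<le> e"
  shows "Lp_norm p f \<le> e * measure area (space area) powr (1 / p)"
proof -
  have "(\<integral>x. \<bar>f x\<bar> powr p \<partial>area) \<le> (\<integral>x. e powr p \<partial>area)"
    using f le p by (intro integral_mono) (auto simp: Lp_def intro!: powr_mono2)
  then have "Lp_norm p f \<le> (e powr p * measure area (space area)) powr (1 / p)"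
    unfolding Lp_norm_def using p by (intro powr_mono2) (auto intro: integral_nonneg_AE simp: mult.commute)
  also have "\<dots> = e * measure area (space area) powr (1 / p)"
    using e p by (simp add: powr_mult powr_powr)
  finally show ?thesis .
qed

lemma
  assumes f: "f \<in> borel_measurable area" and g: "g \<in> borel_measurable area"
    and fg: "distr area borel g = distr area borel f"
  shows Lp0_distr_cong: "f \<in> Lp0 p \<Longrightarrow> g \<in> Lp0 p"
    and Lp_norm_distr_cong: "Lp_norm p g = Lp_norm p f"
proof -
  have [measurable]: "(\<lambda>y::real. \<bar>y\<bar> powr p) \<in> borel_measurable borel" by measurable
  have i: "integrable area (\<lambda>x. \<bar>u x\<bar> powr p) \<longleftrightarrow> integrable (distr area borel u) (\<lambda>y. \<bar>y\<bar> powr p)"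
    "(\<integral>x. \<bar>u x\<bar> powr p \<partial>area) = (\<integral>y. \<bar>y\<bar> powr p \<partial>distr area borel u)"
    "(\<integral>x. u x \<partial>area) = (\<integral>y. y \<partial>distr area borel u)"
    if "u \<in> borel_measurable area" for u :: "real^3 \<Rightarrow> real"
    using that by (simp_all add: integrable_distr_eq integral_distr)
  show "g \<in> Lp0 p" if "f \<in> Lp0 p"
    using that i[OF f] i[OF g] g fg unfolding Lp0_def Lp_def by simp
  show "Lp_norm p g = Lp_norm p f"
    unfolding Lp_norm_def i(2)[OF f] i(2)[OF g] fg ..
qed

lemma exists_rearrangement_follower:
  assumes p: "1 \<le> p" and f: "f \<in> Lp p" and g: "g \<in> Lp p" and h: "h \<in> borel_measurable area"
    and gh: "distr area borel g = distr area borel h" and \<eta>: "0 < \<eta>"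
  obtains f' where "f' \<in> rearrangements f"
    "Lp_norm p (\<lambda>x. h x - f' x) \<le> Lp_norm p (\<lambda>x. g x - f x) + \<eta>"
proof -
  have m: "f \<in> borel_measurable area" "integrable area (\<lambda>x. \<bar>f x\<bar> powr p)"
    "g \<in> borel_measurable area" "integrable area (\<lambda>x. \<bar>g x\<bar> powr p)"
    using f g by (auto simp: Lp_def)
  have V: "(\<lambda>x::real^3. x $ 3) \<in> borel_measurable area"
    by (intro borel_measurable_area continuous_intros)
  show thesis
    by (rule area.exists_follower[OF p m h gh V measure_area_latitude \<eta>])
      (use that m(1) in \<open>auto simp: Lp_norm_def rearrangements_eq_distr\<close>)
qed

text \<open>The modulus in time is uniform over the sphere, and a uniform bound controls the norm by
  finiteness of the area.\<close>

lemma smooth_solution_Lp_continuous: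
  assumes sol: "smooth_solution \<omega> \<zeta>" and p: "1 \<le> p" and e: "0 < e"
  obtains d where "0 < d" "\<forall>s\<in>{0..T}. \<forall>t\<in>{0..T}. \<bar>s - t\<bar> < d \<longrightarrow> Lp_norm p (\<lambda>x. \<zeta> s x - \<zeta> t x) \<le> e"
proof -
  let ?c = "measure area (space area) powr (1 / p)"
  have e': "0 < e / (?c + 1)" using e by (simp add: add_nonneg_pos)
  obtain d where d: "0 < d" "\<forall>x\<in>S2. \<forall>s\<in>{0..T}. \<forall>t\<in>{0..T}. \<bar>s - t\<bar> < d
      \<longrightarrow> \<bar>(case (x, s) of (x, t) \<Rightarrow> \<zeta> t x) - (case (x, t) of (x, t) \<Rightarrow> \<zeta> t x)\<bar> < e / (?c + 1)"
    by (rule uniformly_continuous_in_time[OF smooth_solution_continuous_on[OF sol] e', of T])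
  have "Lp_norm p (\<lambda>x. \<zeta> s x - \<zeta> t x) \<le> e" if st: "s \<in> {0..T}" "t \<in> {0..T}" "\<bar>s - t\<bar> < d" for s t
  proof -
    have L: "\<zeta> s \<in> Lp p" "\<zeta> t \<in> Lp p"
      using smooth_solution_Lp0[OF sol] st p by (auto intro!: Lp0_imp_Lp)
    have "Lp_norm p (\<lambda>x. \<zeta> s x - \<zeta> t x) \<le> e / (?c + 1) * ?c"
      using d(2) st e' by (intro Lp_norm_le_sup[OF p Lp_diff[OF p L]]) (auto simp: less_imp_le)
    also have "\<dots> = e * (?c / (?c + 1))" by simp
    also have "\<dots> \<le> e * 1"
      using e by (intro mult_left_mono) (auto simp: divide_le_eq_1 add_nonneg_pos)
    finally show ?thesis by simp
  qed
  then show thesis using d(1) by (intro that[of d]) auto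
qed

text \<open>A minimising sequence in \<open>N\<close> has a subsequence converging to an element of
  \<open>N\<close>, and by the triangle inequality that element realises the infimum. Hence the
  \<open>LEAST\<close> in \<open>min_dist\<close> exists and equals the infimum.\<close>

lemma min_dist_attained:
  assumes p: "1 \<le> p" and N: "N \<subseteq> Lp p" "N \<noteq> {}" and g: "g \<in> Lp p"
    and compact: "\<And>f. (\<And>n. f n \<in> N) \<Longrightarrow> \<exists>\<kappa> h. h \<in> N \<and> strict_mono (\<kappa> :: nat \<Rightarrow> nat)
      \<and> (\<lambda>j. Lp_norm p (\<lambda>x. f (\<kappa> j) x - h x)) \<longlonglongrightarrow> 0"
  shows "\<exists>f\<in>N. min_dist p N g = Lp_norm p (\<lambda>x. f x - g x)"
    and "v \<in> N \<Longrightarrow> min_dist p N g \<le> Lp_norm p (\<lambda>x. v x - g x)"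
proof -
  let ?D = "\<lambda>f. Lp_norm p (\<lambda>x. f x - g x)"
  define m where "m = Inf (?D ` N)"
  have bdd: "bdd_below (?D ` N)" by (rule bdd_belowI[of _ 0]) (auto simp: Lp_norm_nonneg)
  have lower: "m \<le> ?D f" if "f \<in> N" for f
    unfolding m_def using that by (intro cInf_lower bdd) auto
  have "\<exists>f\<in>N. ?D f < m + 1 / real (Suc n)" for n
  proof -
    have "m < m + 1 / real (Suc n)" by simp
    then show ?thesis unfolding m_def using cInf_lessD[of "?D ` N"] N(2) by blast
  qed
  then obtain f where f: "\<And>n. f n \<in> N" "\<And>n. ?D (f n) < m + 1 / real (Suc n)" by metis
  obtain \<kappa> h where h: "h \<in> N" "strict_mono \<kappa>"
    "(\<lambda>j. Lp_norm p (\<lambda>x. f (\<kappa> j) x - h x)) \<longlonglongrightarrow> 0"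
    using compact[of f, OF f(1)] by (elim exE conjE) (rule that)
  have "?D h \<le> Lp_norm p (\<lambda>x. f (\<kappa> j) x - h x) + (m + 1 / real (Suc (\<kappa> j)))" for j
    using Lp_norm_triangle[OF p, of h "f (\<kappa> j)" g] Lp_norm_minus_commute[of p h "f (\<kappa> j)"]
      f(1)[of "\<kappa> j"] f(2)[of "\<kappa> j"] h(1) N(1) g by (auto simp: subset_iff)
  moreover have "(\<lambda>n. 1 / real (Suc n)) \<longlonglongrightarrow> 0"
    using LIMSEQ_inverse_real_of_nat by (simp add: inverse_eq_divide)
  then have "(\<lambda>j. 1 / real (Suc (\<kappa> j))) \<longlonglongrightarrow> 0"
    using LIMSEQ_subseq_LIMSEQ[OF _ h(2)] by (force simp: comp_def)
  then have "(\<lambda>j. Lp_norm p (\<lambda>x. f (\<kappa> j) x - h x) + (m + 1 / real (Suc (\<kappa> j)))) \<longlonglongrightarrow> 0 + (m + 0)"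
    by (intro tendsto_intros h(3))
  ultimately have "?D h \<le> 0 + (m + 0)" by (intro LIMSEQ_le_const) auto
  then have hm: "?D h = m" using lower[OF h(1)] by simp
  then have md: "min_dist p N g = m"
    unfolding min_dist_def using h(1) lower by (intro Least_equality) auto
  show "\<exists>f\<in>N. min_dist p N g = ?D f" using h(1) hm md by auto
  show "v \<in> N \<Longrightarrow> min_dist p N g \<le> ?D v" using lower md by simp
qed

theorem theorem4p1:
  fixes p \<omega> M :: real
    and f0 :: "real^3 \<Rightarrow> real"
    and E :: "(real^3 \<Rightarrow> real) \<Rightarrow> real"
    and \<R> \<M> \<N> :: "(real^3 \<Rightarrow> real) set"
  assumes p: "1 < p"
    and f0: "f0 \<in> Lp0 p"
    and R: "\<R> = rearrangements f0"
    and i: "\<forall>r>0. \<forall>\<epsilon>>0. \<exists>\<delta>>0. \<forall>f1 \<in> Lp0 p. \<forall>f2 \<in> Lp0 p.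
      Lp_norm p f1 \<le> r \<longrightarrow> Lp_norm p f2 \<le> r \<longrightarrow>
      Lp_norm p (\<lambda>x. f1 x - f2 x) < \<delta> \<longrightarrow> \<bar>E f1 - E f2\<bar> < \<epsilon>"
    and ii: "\<forall>\<zeta>. smooth_solution \<omega> \<zeta> \<longrightarrow> (\<forall>t>0. E (\<zeta> t) = E (\<zeta> 0))"
    and M_nonempty: "\<M> \<noteq> {}"
    and a: "\<M> = {f \<in> \<R>. E f = M}"
    and b: "\<forall>f :: nat \<Rightarrow> real^3 \<Rightarrow> real. (\<forall>n. f n \<in> \<R>) \<longrightarrow> (\<lambda>n. E (f n)) \<longlonglongrightarrow> M \<longrightarrow>
      (\<exists>\<kappa>. strict_mono \<kappa> \<and> (\<exists>g \<in> \<M>. (\<lambda>j. Lp_norm p (\<lambda>x. f (\<kappa> j) x - g x)) \<longlonglongrightarrow> 0))"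
    and N: "\<N> \<subseteq> \<M>" "\<N> \<noteq> {}"
    and isolated: "Lp_isolated p \<N> \<M>"
  shows "\<forall>\<epsilon>>0. \<exists>\<delta>>0. \<forall>\<zeta>. smooth_solution \<omega> \<zeta> \<longrightarrow>
    min_dist p \<N> (\<zeta> 0) < \<delta> \<longrightarrow> (\<forall>t>0. min_dist p \<N> (\<zeta> t) < \<epsilon>)"
proof (intro allI impI)
  fix \<epsilon> :: real assume \<epsilon>: "0 < \<epsilon>"
  have p1: "1 \<le> p" using p by simp
  have f0m: "f0 \<in> borel_measurable area" using f0 by (simp add: Lp0_def Lp_def)
  have R_iff: "f \<in> \<R> \<longleftrightarrow> f \<in> borel_measurable area \<and> distr area borel f = distr area borel f0" for f
    unfolding R rearrangements_eq_distr[OF f0m] by simp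
  have R_Lp0: "f \<in> Lp0 p" and R_norm: "Lp_norm p f = Lp_norm p f0" if "f \<in> \<R>" for f
    using that f0 Lp0_distr_cong[OF f0m] Lp_norm_distr_cong[OF f0m] by (auto simp: R_iff)
  have R_Lp: "f \<in> Lp p" if "f \<in> \<R>" for f using R_Lp0[OF that] by (rule Lp0_imp_Lp)
  have NR: "f \<in> \<R>" "E f = M" if "f \<in> \<N>" for f using that N(1) a by auto
  have NLp: "\<N> \<subseteq> Lp p" using NR R_Lp by blast
  have sol_Lp0: "\<zeta> t \<in> Lp0 p" if "smooth_solution \<omega> \<zeta>" "0 \<le> t" for \<zeta> t
    using smooth_solution_Lp0[OF that] p by simp
  then have sol_Lp: "\<zeta> t \<in> Lp p" if "smooth_solution \<omega> \<zeta>" "0 \<le> t" for \<zeta> t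
    using that Lp0_imp_Lp by blast
  obtain c where c: "0 < c" "\<And>f g. f \<in> \<N> \<Longrightarrow> g \<in> \<M> - \<N> \<Longrightarrow> c \<le> Lp_norm p (\<lambda>x. f x - g x)"
  proof -
    let ?i = "INF (f, g) \<in> \<N> \<times> (\<M> - \<N>). ereal (Lp_norm p (\<lambda>x. f x - g x))"
    have "0 < ?i" using isolated by (simp add: Lp_isolated_def)
    \<comment> \<open>A real number strictly below the infimum is chosen because the infimum is
      infinite when \<open>\<M> - \<N>\<close> is empty.\<close>
    then obtain c where c: "0 < ereal c" "ereal c < ?i" using ereal_dense2 by blast
    have "c \<le> Lp_norm p (\<lambda>x. f x - g x)" if "f \<in> \<N>" "g \<in> \<M> - \<N>" for f g
    proof -
      have "?i \<le> ereal (Lp_norm p (\<lambda>x. f x - g x))"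
        using that by (intro INF_lower2[of "(f, g)"]) auto
      from less_le_trans[OF c(2) this] show ?thesis by simp
    qed
    then show thesis using that c(1) by simp
  qed
  \<comment> \<open>Elements of \<open>\<N>\<close> have energy \<open>M\<close>, so (b) yields a
    limit in \<open>\<M>\<close>; a limit outside \<open>\<N>\<close> would stay at distance at
    least \<open>c\<close> from the sequence.\<close>
  have compact: "\<exists>\<kappa> h. h \<in> \<N> \<and> strict_mono (\<kappa> :: nat \<Rightarrow> nat) \<and> (\<lambda>j. Lp_norm p (\<lambda>x. f (\<kappa> j) x - h x)) \<longlonglongrightarrow> 0"
    if f: "\<And>n. f n \<in> \<N>" for f
  proof -
    have "(\<lambda>n. E (f n)) \<longlonglongrightarrow> M" using NR[OF f] by simp
    then obtain \<kappa> h where h: "strict_mono \<kappa>" "h \<in> \<M>" "(\<lambda>j. Lp_norm p (\<lambda>x. f (\<kappa> j) x - h x)) \<longlonglongrightarrow> 0"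
      using b NR[OF f] by blast
    have "h \<in> \<N>"
    proof (rule ccontr)
      assume "h \<notin> \<N>"
      then have "c \<le> Lp_norm p (\<lambda>x. f (\<kappa> j) x - h x)" for j using c(2) f h(2) by blast
      then have "c \<le> 0" using h(3) by (intro LIMSEQ_le_const) auto
      then show False using c(1) by simp
    qed
    then show ?thesis using h by blast
  qed
  let ?d = "min_dist p \<N>"
  note md = min_dist_attained[OF p1 NLp N(2) _ compact]
  have d_lip: "?d g \<le> ?d h + Lp_norm p (\<lambda>x. g x - h x)" if gh: "g \<in> Lp p" "h \<in> Lp p" for g h
  proof -
    obtain f where f: "f \<in> \<N>" "?d h = Lp_norm p (\<lambda>x. f x - h x)" using md(1)[OF gh(2)] by blast
    have "?d g \<le> Lp_norm p (\<lambda>x. f x - g x)" by (rule md(2)[OF gh(1)]) (use f in auto)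
    also have "\<dots> \<le> Lp_norm p (\<lambda>x. f x - h x) + Lp_norm p (\<lambda>x. h x - g x)"
      by (rule Lp_norm_triangle[OF p1]) (use f(1) NLp gh in auto)
    finally show ?thesis by (simp add: f(2) Lp_norm_minus_commute[of p h g])
  qed
  \<comment> \<open>This is what the intermediate value theorem needs to find a time at distance
    exactly \<open>\<epsilon>'\<close>.\<close>
  have d_cont: "continuous_on {0..T} (\<lambda>t. ?d (\<zeta> t))" if sol: "smooth_solution \<omega> \<zeta>" for \<zeta> T
  proof (rule continuous_onI)
    fix t e :: real assume e: "0 < e" and t: "t \<in> {0..T}"
    obtain \<delta> where \<delta>: "0 < \<delta>" "\<forall>s\<in>{0..T}. \<forall>t\<in>{0..T}. \<bar>s - t\<bar> < \<delta> \<longrightarrow> Lp_norm p (\<lambda>x. \<zeta> s x - \<zeta> t x) \<le> e"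
      by (rule smooth_solution_Lp_continuous[OF sol p1 e, of T])
    have "dist (?d (\<zeta> s)) (?d (\<zeta> t)) \<le> e" if s: "s \<in> {0..T}" "dist s t < \<delta>" for s
    proof -
      have "Lp_norm p (\<lambda>x. \<zeta> s x - \<zeta> t x) \<le> e" using \<delta>(2) s t by (auto simp: dist_real_def)
      moreover have "\<zeta> s \<in> Lp p" "\<zeta> t \<in> Lp p" using sol_Lp[OF sol] s t by auto
      ultimately show ?thesis
        using d_lip[of "\<zeta> s" "\<zeta> t"] d_lip[of "\<zeta> t" "\<zeta> s"] Lp_norm_minus_commute[of p "\<zeta> s" "\<zeta> t"]
        by (auto simp: dist_real_def abs_le_iff)
    qed
    then show "\<exists>\<delta>>0. \<forall>s\<in>{0..T}. dist s t < \<delta> \<longrightarrow> dist (?d (\<zeta> s)) (?d (\<zeta> t)) \<le> e" using \<delta>(1) by blast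
  qed
  \<comment> \<open>At most \<open>\<epsilon>\<close>, so that a solution violating stability passes
    through \<open>\<epsilon>'\<close>; below \<open>c\<close>, so that a limit at this distance
    from \<open>\<N>\<close> cannot lie in \<open>\<M> - \<N>\<close>.\<close>
  define \<epsilon>' where "\<epsilon>' = min \<epsilon> (c / 2)"
  \<comment> \<open>The shift by 2 gives \<open>2 * \<eta> n \<le> \<epsilon>'\<close> already for
    \<open>n = 0\<close>: solutions start strictly inside the distance \<open>\<epsilon>'\<close>,
    and followers stay within it.\<close>
  define \<eta> where "\<eta> n = \<epsilon>' / real (n + 2)" for n
  have \<epsilon>': "0 < \<epsilon>'" "\<epsilon>' \<le> \<epsilon>" "\<epsilon>' < c" using \<epsilon> c(1) by (auto simp: \<epsilon>'_def)
  have \<eta>: "0 < \<eta> n" "2 * \<eta> n \<le> \<epsilon>'" for n using \<epsilon>'(1) by (simp_all add: \<eta>_def field_simps)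
  have \<eta>_lim: "\<eta> \<longlonglongrightarrow> 0"
    unfolding \<eta>_def by (rule LIMSEQ_ignore_initial_segment[OF lim_const_over_n])
  show "\<exists>\<delta>>0. \<forall>\<zeta>. smooth_solution \<omega> \<zeta> \<longrightarrow> ?d (\<zeta> 0) < \<delta> \<longrightarrow> (\<forall>t>0. ?d (\<zeta> t) < \<epsilon>)"
  proof (rule ccontr)
    assume neg: "\<not> ?thesis"
    define Q where "Q n = (\<lambda>(f, \<zeta>, s, u). f \<in> \<R> \<and> smooth_solution \<omega> \<zeta> \<and> 0 < s \<and> u \<in> \<N> \<and> ?d (\<zeta> s) = \<epsilon>'
        \<and> Lp_norm p (\<lambda>x. u x - \<zeta> 0 x) < \<eta> n \<and> Lp_norm p (\<lambda>x. \<zeta> s x - f x) < 2 * \<eta> n)" for n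
    have "\<exists>w. Q n w" for n
    proof -
      obtain \<zeta> t where sol: "smooth_solution \<omega> \<zeta>" and close: "?d (\<zeta> 0) < \<eta> n" and t: "0 < t" "\<epsilon> \<le> ?d (\<zeta> t)"
        using neg \<eta>(1)[of n] by (metis not_le)
      have "?d (\<zeta> 0) \<le> \<epsilon>'" "\<epsilon>' \<le> ?d (\<zeta> t)" using close \<eta>[of n] \<epsilon>' t by linarith+
      then obtain s where s: "0 \<le> s" "s \<le> t" "?d (\<zeta> s) = \<epsilon>'"
        using IVT'[of "\<lambda>t. ?d (\<zeta> t)" 0 \<epsilon>' t] t(1) d_cont[OF sol] by auto
      have "s \<noteq> 0" using s(3) close \<eta>[of n] by auto
      then have s0: "0 < s" using s(1) by simp
      obtain u where u: "u \<in> \<N>" "?d (\<zeta> 0) = Lp_norm p (\<lambda>x. u x - \<zeta> 0 x)"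
        using md(1)[OF sol_Lp[OF sol]] by blast
      have uc: "Lp_norm p (\<lambda>x. u x - \<zeta> 0 x) < \<eta> n" using close u(2) by simp
      have \<zeta>m: "\<zeta> s \<in> borel_measurable area" using sol_Lp[OF sol s(1)] by (simp add: Lp_def)
      have um: "u \<in> borel_measurable area" using NR(1)[OF u(1)] R_iff by simp
      obtain f where f: "f \<in> rearrangements u"
        "Lp_norm p (\<lambda>x. \<zeta> s x - f x) \<le> Lp_norm p (\<lambda>x. \<zeta> 0 x - u x) + \<eta> n"
        by (rule exists_rearrangement_follower[OF p1 _ sol_Lp[OF sol] \<zeta>m
              smooth_solution_distr_eq[OF sol s0, symmetric] \<eta>(1)])
          (use u NLp in auto)
      have "f \<in> \<R>" using f(1) NR(1)[OF u(1)] by (simp add: R_iff rearrangements_eq_distr[OF um])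
      moreover have "Lp_norm p (\<lambda>x. \<zeta> s x - f x) < 2 * \<eta> n"
        using f(2) uc Lp_norm_minus_commute[of p u "\<zeta> 0"] by simp
      ultimately have "Q n (f, \<zeta>, s, u)" using sol s0 s(3) u(1) uc by (simp add: Q_def)
      then show ?thesis ..
    qed
    then obtain w where w: "\<And>n. Q n (w n)" by metis
    define F where "F n = fst (w n)" for n
    define \<zeta> where "\<zeta> n = fst (snd (w n))" for n
    define s where "s n = fst (snd (snd (w n)))" for n
    define u where "u n = snd (snd (snd (w n)))" for n
    have F: "F n \<in> \<R>" and sol: "smooth_solution \<omega> (\<zeta> n)"
      and s: "0 < s n" and u: "u n \<in> \<N>" and ds: "?d (\<zeta> n (s n)) = \<epsilon>'"
      and uc: "Lp_norm p (\<lambda>x. u n x - \<zeta> n 0 x) < \<eta> n"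
      and Fc: "Lp_norm p (\<lambda>x. \<zeta> n (s n) x - F n x) < 2 * \<eta> n" for n
      using w[of n] by (simp_all add: Q_def case_prod_unfold F_def \<zeta>_def s_def u_def)
    have \<zeta>0: "\<zeta> n 0 \<in> Lp0 p" and \<zeta>s: "\<zeta> n (s n) \<in> Lp0 p" for n
      using sol_Lp0[OF sol[of n]] s[of n] by auto
    have "(\<lambda>n. E (F n)) \<longlonglongrightarrow> M"
    proof (rule LIMSEQ_I)
      fix e :: real assume e: "0 < e"
      \<comment> \<open>One radius for all functions to be compared: rearrangements share the norm
        of \<open>f0\<close>, and both \<open>\<zeta> n 0\<close> and \<open>\<zeta> n (s n)\<close>
        lie within \<open>\<epsilon>'\<close> of a rearrangement.\<close>
      define r where "r = Lp_norm p f0 + \<epsilon>'"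
      have r: "0 < r" using \<epsilon>'(1) Lp_norm_nonneg[of p f0] by (simp add: r_def)
      have e2: "0 < e / 2" using e by simp
      obtain \<delta> where \<delta>: "0 < \<delta>" "\<forall>f1 \<in> Lp0 p. \<forall>f2 \<in> Lp0 p. Lp_norm p f1 \<le> r \<longrightarrow> Lp_norm p f2 \<le> r
          \<longrightarrow> Lp_norm p (\<lambda>x. f1 x - f2 x) < \<delta> \<longrightarrow> \<bar>E f1 - E f2\<bar> < e / 2"
        using i[rule_format, OF r e2] by (elim exE conjE) (rule that)
      have "(\<lambda>n. 2 * \<eta> n) \<longlonglongrightarrow> 2 * 0" by (intro tendsto_intros \<eta>_lim)
      then have "\<forall>\<^sub>F n in sequentially. 2 * \<eta> n < \<delta>" using \<delta>(1) by (intro order_tendstoD) auto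
      then obtain n0 where n0: "\<And>n. n0 \<le> n \<Longrightarrow> 2 * \<eta> n < \<delta>" by (auto simp: eventually_sequentially)
      \<comment> \<open>The energy passes from \<open>u n\<close>, where it is \<open>M\<close>, to
        \<open>\<zeta> n 0\<close> with error below \<open>e / 2\<close>, then without loss to
        \<open>\<zeta> n (s n)\<close>, then to \<open>F n\<close> with error below
        \<open>e / 2\<close>.\<close>
      have "norm (E (F n) - M) < e" if "n0 \<le> n" for n
      proof -
        have nu: "Lp_norm p (u n) = Lp_norm p f0" and nF: "Lp_norm p (F n) = Lp_norm p f0"
          using R_norm NR(1)[OF u] F by auto
        have "Lp_norm p (\<zeta> n 0) \<le> r"
          using Lp_norm_le_sum[OF p1 Lp0_imp_Lp[OF \<zeta>0[of n]] R_Lp[OF NR(1)[OF u[of n]]]] uc[of n] \<eta>[of n] nu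
            Lp_norm_minus_commute[of p "\<zeta> n 0" "u n"] by (simp add: r_def)
        then have "\<bar>E (u n) - E (\<zeta> n 0)\<bar> < e / 2"
          using n0[OF that] uc[of n] \<eta>[of n] nu \<epsilon>'(1) \<zeta>0 R_Lp0[OF NR(1)[OF u[of n]]]
          by (intro \<delta>(2)[rule_format]) (auto simp: r_def)
        moreover have "Lp_norm p (\<zeta> n (s n)) \<le> r"
          using Lp_norm_le_sum[OF p1 Lp0_imp_Lp[OF \<zeta>s[of n]] R_Lp[OF F[of n]]] Fc[of n] \<eta>[of n] nF
          by (simp add: r_def)
        then have "\<bar>E (\<zeta> n (s n)) - E (F n)\<bar> < e / 2"
          using n0[OF that] Fc[of n] nF \<epsilon>'(1) \<zeta>s R_Lp0[OF F[of n]]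
          by (intro \<delta>(2)[rule_format]) (auto simp: r_def)
        moreover have "E (\<zeta> n (s n)) = E (\<zeta> n 0)" using ii sol s by blast
        ultimately show ?thesis using NR(2)[OF u[of n]] unfolding real_norm_def by linarith
      qed
      then show "\<exists>n0. \<forall>n\<ge>n0. norm (E (F n) - M) < e" by blast
    qed
    then obtain \<kappa> g where \<kappa>: "strict_mono \<kappa>" and g: "g \<in> \<M>"
      and lim: "(\<lambda>j. Lp_norm p (\<lambda>x. F (\<kappa> j) x - g x)) \<longlonglongrightarrow> 0"
      using b F by blast
    have gLp: "g \<in> Lp p" using g a R_Lp by blast
    define \<tau> where "\<tau> j = 2 * \<eta> (\<kappa> j) + Lp_norm p (\<lambda>x. F (\<kappa> j) x - g x)" for j
    have "(\<lambda>j. \<eta> (\<kappa> j)) \<longlonglongrightarrow> 0"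
      using LIMSEQ_subseq_LIMSEQ[OF \<eta>_lim \<kappa>] by (simp add: comp_def)
    then have "\<tau> \<longlonglongrightarrow> 2 * 0 + 0" unfolding \<tau>_def by (intro tendsto_intros lim)
    then have \<tau>: "\<tau> \<longlonglongrightarrow> 0" by simp
    have \<zeta>g: "Lp_norm p (\<lambda>x. \<zeta> (\<kappa> j) (s (\<kappa> j)) x - g x) \<le> \<tau> j" for j
      using Lp_norm_triangle[OF p1 Lp0_imp_Lp[OF \<zeta>s[of "\<kappa> j"]] R_Lp[OF F[of "\<kappa> j"]] gLp] Fc[of "\<kappa> j"]
      by (simp add: \<tau>_def)
    \<comment> \<open>The vorticities at the times \<open>s (\<kappa> j)\<close> tend to
      \<open>g\<close> but stay at distance \<open>\<epsilon>'\<close> from \<open>\<N>\<close>: a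
      limit in \<open>\<N>\<close> would force \<open>\<epsilon>' \<le> 0\<close>, and one in
      \<open>\<M> - \<N>\<close> would force \<open>c \<le> \<epsilon>'\<close>.\<close>
    show False
    proof (cases "g \<in> \<N>")
      case True
      have "\<epsilon>' \<le> \<tau> j" for j
        using md(2)[OF Lp0_imp_Lp[OF \<zeta>s[of "\<kappa> j"]], of g] True ds[of "\<kappa> j"] \<zeta>g[of j]
          Lp_norm_minus_commute[of p g "\<zeta> (\<kappa> j) (s (\<kappa> j))"] by simp
      then have "\<epsilon>' \<le> 0" by (intro LIMSEQ_le_const[OF \<tau>]) auto
      then show False using \<epsilon>'(1) by simp
    next
      case False
      have "c - \<epsilon>' \<le> \<tau> j" for j
      proof -
        obtain v where v: "v \<in> \<N>" "?d (\<zeta> (\<kappa> j) (s (\<kappa> j))) = Lp_norm p (\<lambda>x. v x - \<zeta> (\<kappa> j) (s (\<kappa> j)) x)"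
          using md(1)[OF Lp0_imp_Lp[OF \<zeta>s]] by blast
        have "c \<le> Lp_norm p (\<lambda>x. v x - g x)" using c(2) v(1) g False by blast
        also have "\<dots> \<le> \<epsilon>' + Lp_norm p (\<lambda>x. \<zeta> (\<kappa> j) (s (\<kappa> j)) x - g x)"
          using Lp_norm_triangle[OF p1 _ Lp0_imp_Lp[OF \<zeta>s[of "\<kappa> j"]] gLp, of v] v NLp ds by auto
        finally show ?thesis using \<zeta>g[of j] by simp
      qed
      then have "c - \<epsilon>' \<le> 0" by (intro LIMSEQ_le_const[OF \<tau>]) auto
      then show False using \<epsilon>'(3) by simp
    qed
  qed
qed

end
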